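(* Let $\ell:\mathbb{R}^n\times\mathcal{Y}\to\mathbb{R}$ be a loss such that $\ell(\cdot,y)$ is $\mathcal{C}^2$ on $\mathbb{R}^n$ for every $y\in\mathcal{Y}$, and such that $\operatorname{span}_{y\in\mathcal{Y}}\{\nabla_z\ell(z,y)\}=\mathbb{R}^n$ for all $z\in\mathbb{R}^n$. (1) (Linear networks of any depth.) Let $q\ge 1$, $n_0=n$, $n_q=m$, $\theta=(U_1,\dots,U_q)$ with $U_i\in\mathbb{R}^{n_{i-1}\times n_i}$, $\Theta=\mathbb{R}^D$ the space of all such $\theta$, $g(\theta,x)=U_1\cdots U_q x$ for $x\in\mathbb{R}^m$, and $\phi(\theta)=U_1\cdots U_q\in\mathbb{R}^{n\times m}\cong\mathbb{R}^d$, $d=nm$. Then $W^g_\theta=W_\phi(\theta)$ for all $\theta\in\Theta$. (2) (Two-layer ReLU networks.) Let $\sigma(t)=\max(t,0)$, $\theta=(U,V,b,c)\in\mathbb{R}^{n\times r}\times\mathbb{R}^{m\times r}\times\mathbb{R}^r\times\mathbb{R}^n=\mathbb{R}^D$, with $u_j$, $v_j$ the columns of $U$, $V$ and $b_j$ the entries of $b$, let $g(\theta,x)=\sum_{j=1}^r u_j\,\sigma(v_j^\top x+b_j)+c$ for $x\in\mathbb{R}^m$, and $\phi(\theta)=((u_jv_j^\top,\,u_jb_j)_{j=1}^r,\,c)\in\mathbb{R}^d$, $d=rn(m+1)+n$. Let $\Theta\subseteq\mathbb{R}^D$ be the (open) set of parameters $\theta$ such that $v_j\neq0$ for all $j$ and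 the hyperplanes $\mathcal{H}_j=\{x\in\mathbb{R}^m: v_j^\top x+b_j=0\}$, $j=1,\dots,r$, are pairwise distinct. Then $W^g_\theta=W_\phi(\theta)$ for all $\theta\in\Theta$. The same holds for the networks without biases, i.e. with $\theta=(U,V)$, $g(\theta,x)=\sum_{j=1}^r u_j\,\sigma(v_j^\top x)$, $\phi(\theta)=(u_jv_j^\top)_{j=1}^r\in\mathbb{R}^{rnm}$, and $\Theta$ the set of $\theta$ with all $v_j\ne 0$ and pairwise distinct hyperplanes $\{x: v_j^\top x=0\}$.
   Context: $\mathcal{Y}$ is the set of targets/labels. For a finite data set $(X,Y)=((x_i)_i,(y_i)_i)$ with $x_i\in\mathbb{R}^m$, $y_i\in\mathcal{Y}$, put $\mathcal{E}_{X,Y}(\theta)=\sum_i\ell(g(\theta,x_i),y_i)$. For $\Omega\subseteq\Theta$ open, let $$W^g_\Omega=\{\nabla\mathcal{E}_{X,Y}|_\Omega:\ (X,Y)\text{ a finite data set with } g(\cdot,x_i)\in\mathcal{C}^2(\Omega,\mathbb{R}^n)\ \forall i\}\subseteq\mathcal{C}^1(\Omega,\mathbb{R}^D).$$ For a set $W$ of vector fields on $\Omega$, its trace at $\theta\in\Omega$ is $W(\theta)=\operatorname{span}\{\chi(\theta):\chi\in W\}\subseteq\mathbb{R}^D$. Define $$W^g_\theta=\bigcup\{W^g_\Omega(\theta):\ \Omega\subseteq\Theta\text{ an open neighborhood of }\theta\}.$$ For $\phi=(\phi_1,\dots,\phi_d)$, $W_\phi=\operatorname{span}\{\nabla\phi_1(\cdot),\dots,\nabla\phi_d(\cdot)\}$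 (real linear combinations of the vector fields $\nabla\phi_i$), so that $W_\phi(\theta)=\operatorname{span}\{\nabla\phi_i(\theta)\}=\operatorname{range}(\partial\phi(\theta)^\top)$, where $\partial\phi(\theta)$ is the Jacobian. *)

theory Defs
  imports "HOL-Analysis.Analysis"
begin

section \<open>Gradients and $C^2$ maps\<close>

definition grad :: "('a::real_inner \<Rightarrow> real) \<Rightarrow> 'a \<Rightarrow> 'a" where
  "grad f x = (THE D. GDERIV f x :> D)"

lemma grad_eqI: "GDERIV f x :> D \<Longrightarrow> grad f x = D"
  unfolding grad_def
proof (rule the_equality)
  fix D' assume *: "GDERIV f x :> D" "GDERIV f x :> D'"
  have "inner h D' = inner h D" for h
    using has_derivative_unique[OF *[unfolded gderiv_def]] by (metis (full_types))
  then show "D' = D"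
    by (meson vector_eq_rdot inner_commute vector_eq_ldot)
qed

text \<open>Continuous differentiability of order 1 and 2, meant for open \<open>S\<close>; the derivative is
  a map into the normed space of bounded linear functions.\<close>

definition C1_on :: "'a::real_normed_vector set \<Rightarrow> ('a \<Rightarrow> 'b::real_normed_vector) \<Rightarrow> bool" where
  "C1_on S f \<longleftrightarrow> (\<exists>f' :: 'a \<Rightarrow> 'a \<Rightarrow>\<^sub>L 'b.
     (\<forall>x\<in>S. (f has_derivative blinfun_apply (f' x)) (at x)) \<and> continuous_on S f')"

definition C2_on :: "'a::real_normed_vector set \<Rightarrow> ('a \<Rightarrow> 'b::real_normed_vector) \<Rightarrow> bool" where
  "C2_on S f \<longleftrightarrow> (\<exists>f' :: 'a \<Rightarrow> 'a \<Rightarrow>\<^sub>L 'b.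
     (\<forall>x\<in>S. (f has_derivative blinfun_apply (f' x)) (at x)) \<and> C1_on S f')"


section \<open>Vector fields attached to a loss, a model and a map of the parameters\<close>

definition emp_loss ::
  "('z \<Rightarrow> 'y \<Rightarrow> real) \<Rightarrow> ('a \<Rightarrow> 'x \<Rightarrow> 'z) \<Rightarrow> ('x \<times> 'y) list \<Rightarrow> 'a \<Rightarrow> real" where
  "emp_loss l g ds \<theta> = (\<Sum>(x, y)\<leftarrow>ds. l (g \<theta> x) y)"

definition W_on ::
  "('z::real_normed_vector \<Rightarrow> 'y \<Rightarrow> real) \<Rightarrow> ('a::euclidean_space \<Rightarrow> 'x \<Rightarrow> 'z) \<Rightarrow> 'a set
     \<Rightarrow> ('a \<Rightarrow> 'a) set" where
  "W_on l g \<Omega> = {restrict (grad (emp_loss l g ds)) \<Omega> | ds.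
     \<forall>(x, y) \<in> set ds. C2_on \<Omega> (\<lambda>\<theta>. g \<theta> x)}"

definition trace_at :: "('a \<Rightarrow> 'a::real_vector) set \<Rightarrow> 'a \<Rightarrow> 'a set" where
  "trace_at W \<theta> = span {F \<theta> | F. F \<in> W}"

definition W_at ::
  "'a set \<Rightarrow> ('z::real_normed_vector \<Rightarrow> 'y \<Rightarrow> real) \<Rightarrow> ('a::euclidean_space \<Rightarrow> 'x \<Rightarrow> 'z) \<Rightarrow> 'a
     \<Rightarrow> 'a set" where
  "W_at \<Theta> l g \<theta> = \<Union>{trace_at (W_on l g \<Omega>) \<theta> | \<Omega>. open \<Omega> \<and> \<Omega> \<subseteq> \<Theta> \<and> \<theta> \<in> \<Omega>}"

text \<open>The target of \<open>\<phi>\<close> is any Euclidean space, with the elements of \<open>Basis\<close> as its coordinate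
  axes, so that matrices and tuples of them need not be flattened to \<open>\<real>\<^sup>d\<close>.  The span is
  written out because functions do not form an instance of \<open>real_vector\<close>.\<close>

definition W_of :: "('a::euclidean_space \<Rightarrow> 'b::euclidean_space) \<Rightarrow> ('a \<Rightarrow> 'a) set" where
  "W_of \<phi> = {\<lambda>\<theta>. \<Sum>b\<in>Basis. c b *\<^sub>R grad (\<lambda>\<theta>. \<phi> \<theta> \<bullet> b) \<theta> | c. True}"


section \<open>Linear networks\<close>

text \<open>With \<open>U i j k\<close> the \<open>(j,k)\<close> entry of the \<open>i\<close>-th matrix, which has size
  \<open>dims (i - 1) \<times> dims i\<close> and indices starting at 0, \<open>mat_prod dims U q\<close> is
  the product of the matrices numbered \<open>1, \<dots>, q\<close>.\<close>

primrec mat_prod ::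
  "(nat \<Rightarrow> nat) \<Rightarrow> (nat \<Rightarrow> nat \<Rightarrow> nat \<Rightarrow> real) \<Rightarrow> nat \<Rightarrow> nat \<Rightarrow> nat \<Rightarrow> real" where
  "mat_prod dims U 0 = (\<lambda>j k. if j = k then 1 else 0)"
| "mat_prod dims U (Suc i) =
     (\<lambda>j k. \<Sum>h<dims i. mat_prod dims U i j h * U (Suc i) h k)"

text \<open>The parameter \<open>\<theta> = (U\<^sub>1, \<dots>, U\<^sub>q)\<close> of a network whose depth and widths are arbitrary numbers
  is a vector in \<open>real ^ 'p\<close>: its coordinates are labelled by the triples (layer, row, column)
  through a bijection \<open>pos\<close>.  Likewise \<open>out_ix\<close> and \<open>in_ix\<close> number the coordinates of
  the output space and of the input space.\<close>

definition entry_index :: "nat \<Rightarrow> (nat \<Rightarrow> nat) \<Rightarrow> (nat \<times> nat \<times> nat) set" where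
  "entry_index q dims = {(i, j, k). 1 \<le> i \<and> i \<le> q \<and> j < dims (i - 1) \<and> k < dims i}"

definition lin_layout ::
  "nat \<Rightarrow> (nat \<Rightarrow> nat) \<Rightarrow> ('n \<Rightarrow> nat) \<Rightarrow> ('m \<Rightarrow> nat) \<Rightarrow> (nat \<times> nat \<times> nat \<Rightarrow> 'p) \<Rightarrow> bool" where
  "lin_layout q dims out_ix in_ix pos \<longleftrightarrow>
     bij_betw out_ix UNIV {..<dims 0} \<and> bij_betw in_ix UNIV {..<dims q} \<and>
     bij_betw pos (entry_index q dims) UNIV"

definition lin_phi ::
  "nat \<Rightarrow> (nat \<Rightarrow> nat) \<Rightarrow> ('n::finite \<Rightarrow> nat) \<Rightarrow> ('m::finite \<Rightarrow> nat) \<Rightarrow> (nat \<times> nat \<times> nat \<Rightarrow> 'p::finite)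
     \<Rightarrow> real^'p \<Rightarrow> real^'m^'n" where
  "lin_phi q dims out_ix in_ix pos \<theta> =
     (\<chi> a b. mat_prod dims (\<lambda>i j k. \<theta> $ pos (i, j, k)) q (out_ix a) (in_ix b))"

definition lin_net ::
  "nat \<Rightarrow> (nat \<Rightarrow> nat) \<Rightarrow> ('n::finite \<Rightarrow> nat) \<Rightarrow> ('m::finite \<Rightarrow> nat) \<Rightarrow> (nat \<times> nat \<times> nat \<Rightarrow> 'p::finite)
     \<Rightarrow> real^'p \<Rightarrow> real^'m \<Rightarrow> real^'n" where
  "lin_net q dims out_ix in_ix pos \<theta> x = lin_phi q dims out_ix in_ix pos \<theta> *v x"


section \<open>Two-layer ReLU networks\<close>

definition relu :: "real \<Rightarrow> real" where
  "relu t = max t 0"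

definition outer :: "real^'n \<Rightarrow> real^'m \<Rightarrow> real^'m^'n" where
  "outer u v = (\<chi> a b. u $ a * v $ b)"

type_synonym ('n, 'm, 'r) bias_params =
  "(real^'r^'n) \<times> (real^'r^'m) \<times> (real^'r) \<times> (real^'n)"

definition relu_net ::
  "('n::finite, 'm::finite, 'r::finite) bias_params \<Rightarrow> real^'m \<Rightarrow> real^'n" where
  "relu_net = (\<lambda>(U, V, b, c) x.
     (\<Sum>j\<in>UNIV. relu (column j V \<bullet> x + b $ j) *\<^sub>R column j U) + c)"

definition relu_phi ::
  "('n::finite, 'm::finite, 'r::finite) bias_params \<Rightarrow> (((real^'m^'n) \<times> (real^'n))^'r) \<times> (real^'n)" where
  "relu_phi = (\<lambda>(U, V, b, c).
     (\<chi> j. (outer (column j U) (column j V), b $ j *\<^sub>R column j U), c))"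

definition relu_dom :: "('n::finite, 'm::finite, 'r::finite) bias_params set" where
  "relu_dom = {(U, V, b, c). (\<forall>j. column j V \<noteq> 0) \<and>
     (\<forall>i j. i \<noteq> j \<longrightarrow>
       {x. column i V \<bullet> x + b $ i = 0} \<noteq> {x. column j V \<bullet> x + b $ j = 0})}"

definition relu_net0 ::
  "(real^'r::finite^'n::finite) \<times> (real^'r^'m::finite) \<Rightarrow> real^'m \<Rightarrow> real^'n" where
  "relu_net0 = (\<lambda>(U, V) x. \<Sum>j\<in>UNIV. relu (column j V \<bullet> x) *\<^sub>R column j U)"

definition relu_phi0 ::
  "(real^'r::finite^'n::finite) \<times> (real^'r^'m::finite) \<Rightarrow> real^'m^'n^'r" where
  "relu_phi0 = (\<lambda>(U, V). \<chi> j. outer (column j U) (column j V))"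

definition relu_dom0 :: "((real^'r::finite^'n::finite) \<times> (real^'r^'m::finite)) set" where
  "relu_dom0 = {(U, V). (\<forall>j. column j V \<noteq> 0) \<and>
     (\<forall>i j. i \<noteq> j \<longrightarrow> {x. column i V \<bullet> x = 0} \<noteq> {x. column j V \<bullet> x = 0})}"

end

theory Submission
  imports Defs
begin

text \<open>Fix \<open>\<theta>\<close> and write \<open>g\<^sub>x = g(\<cdot>, x)\<close>.  Passing to orthogonal complements, \<open>W\<^sub>\<phi>(\<theta>)\<close> becomes the kernel of
  \<open>D\<phi>(\<theta>)\<close>, and since the loss gradients span, \<open>W\<^sub>\<Omega>(\<theta>)\<close> becomes the common kernel of the \<open>Dg\<^sub>x(\<theta>)\<close>
  over the inputs \<open>x\<close> for which \<open>g\<^sub>x\<close> is \<open>C\<^sup>2\<close> on \<open>\<Omega>\<close>.  For linear networks \<open>Dg\<^sub>x(\<theta>) h\<close> is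
  \<open>D\<phi>(\<theta>) h\<close> applied to \<open>x\<close>.

  For ReLU networks \<open>Dg\<^sub>x(\<theta>) h\<close> is, as a function of \<open>x\<close>, affine on each activation region, being the
  sum of one affine map per active neuron and a constant; these affine maps and the constant are
  equivalent to \<open>D\<phi>(\<theta>) h\<close>.  If it vanishes on small balls on the two sides of a point that lies on
  \<open>H\<^sub>j\<close> and on no other hyperplane, subtracting gives that the affine map of neuron \<open>j\<close> is zero.
  Shrinking \<open>\<Omega>\<close> keeps the activation pattern constant on the finitely many balls used.  Conversely, if
  \<open>g\<^sub>x\<close> is differentiable at \<open>\<theta>\<close>, then a neuron whose hyperplane contains \<open>x\<close> has \<open>u\<^sub>j = 0\<close> (or \<open>x = 0\<close> and
  there are no biases), so the same formula for \<open>Dg\<^sub>x(\<theta>)\<close> holds.\<close>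

section \<open>Calculus of \<open>C\<^sup>2\<close> maps\<close>

lemma C1_on_const: "C1_on S (\<lambda>x. a)"
  unfolding C1_on_def by (rule exI[of _ "\<lambda>x. 0"]) (auto simp: zero_blinfun.rep_eq)

lemma C1_on_add:
  assumes "C1_on S f" "C1_on S g"
  shows "C1_on S (\<lambda>x. f x + g x)"
proof -
  obtain f' g' where "\<forall>x\<in>S. (f has_derivative blinfun_apply (f' x)) (at x)" "continuous_on S f'"
    "\<forall>x\<in>S. (g has_derivative blinfun_apply (g' x)) (at x)" "continuous_on S g'"
    using assms unfolding C1_on_def by blast
  then show ?thesis
    unfolding C1_on_def
    by (intro exI[of _ "\<lambda>x. f' x + g' x"])
      (auto simp: plus_blinfun.rep_eq intro!: has_derivative_add continuous_intros)
qed

lemma C1_on_linear_comp: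
  assumes "bounded_linear F" "C1_on S f"
  shows "C1_on S (\<lambda>x. F (f x))"
proof -
  obtain f' where f': "\<forall>x\<in>S. (f has_derivative blinfun_apply (f' x)) (at x)" "continuous_on S f'"
    using assms unfolding C1_on_def by blast
  have "((\<lambda>x. F (f x)) has_derivative blinfun_apply (Blinfun F o\<^sub>L f' x)) (at x)" if "x \<in> S" for x
    using bounded_linear.has_derivative[OF assms(1)] f' that
    by (auto simp: blinfun_compose.rep_eq o_def bounded_linear_Blinfun_apply[OF assms(1)])
  moreover have "continuous_on S (\<lambda>x. Blinfun F o\<^sub>L f' x)"
    by (intro bounded_bilinear.continuous_on[OF bounded_bilinear_blinfun_compose]
        continuous_on_const f')
  ultimately show ?thesis
    unfolding C1_on_def by (intro exI[of _ "\<lambda>x. Blinfun F o\<^sub>L f' x"] conjI ballI)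
qed

text \<open>The derivative given by the product rule is assembled from \<open>f\<close>,
  \<open>g\<close>, \<open>f'\<close> and \<open>g'\<close> by bounded linear maps and by
  composition. Composition is itself bounded bilinear, so the lemma can be reused one order
  higher.\<close>

lemma (in bounded_bilinear) C1_on_prod:
  assumes "C1_on S f" "C1_on S g"
  shows "C1_on S (\<lambda>x. prod (f x) (g x))"
proof -
  obtain f' g' where f': "\<forall>x\<in>S. (f has_derivative blinfun_apply (f' x)) (at x)" "continuous_on S f'"
    and g': "\<forall>x\<in>S. (g has_derivative blinfun_apply (g' x)) (at x)" "continuous_on S g'"
    using assms unfolding C1_on_def by blast
  have cont: "continuous_on S f" "continuous_on S g"
    using f' g' by (meson continuous_at_imp_continuous_on has_derivative_continuous)+
  show ?thesis
    unfolding C1_on_def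
  proof (intro exI conjI ballI)
    fix x assume "x \<in> S"
    then show "((\<lambda>x. prod (f x) (g x)) has_derivative
        blinfun_apply ((prod_right (f x) o\<^sub>L g' x) + (prod_left (g x) o\<^sub>L f' x))) (at x)"
      using FDERIV[of f "blinfun_apply (f' x)" x UNIV g "blinfun_apply (g' x)"] f' g'
      by (auto simp: plus_blinfun.rep_eq blinfun_compose.rep_eq prod_left.rep_eq prod_right.rep_eq)
  next
    show "continuous_on S (\<lambda>x. (prod_right (f x) o\<^sub>L g' x) + (prod_left (g x) o\<^sub>L f' x))"
      by (intro continuous_on_add bounded_bilinear.continuous_on[OF bounded_bilinear_blinfun_compose]
          bounded_linear.continuous_on[OF bounded_linear_prod_right]
          bounded_linear.continuous_on[OF bounded_linear_prod_left] f' g' cont)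
  qed
qed

lemma C2_on_imp_C1_on:
  assumes "C2_on S f"
  shows "C1_on S f"
proof -
  obtain f' where f': "\<forall>x\<in>S. (f has_derivative blinfun_apply (f' x)) (at x)" "C1_on S f'"
    using assms unfolding C2_on_def by blast
  from f'(2) have "continuous_on S f'"
    unfolding C1_on_def by (meson continuous_at_imp_continuous_on has_derivative_continuous)
  with f'(1) show ?thesis
    unfolding C1_on_def by blast
qed

lemma C2_on_bounded_linear:
  assumes "bounded_linear f"
  shows "C2_on S f"
  unfolding C2_on_def
  by (rule exI[of _ "\<lambda>x. Blinfun f"])
    (auto simp: C1_on_const bounded_linear_Blinfun_apply[OF assms] bounded_linear_imp_has_derivative assms)

lemma C2_on_const: "C2_on S (\<lambda>x. a)"
  unfolding C2_on_def by (rule exI[of _ "\<lambda>x. 0"]) (auto simp: C1_on_const zero_blinfun.rep_eq)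

lemma C2_on_add:
  assumes "C2_on S f" "C2_on S g"
  shows "C2_on S (\<lambda>x. f x + g x)"
proof -
  obtain f' g' where "\<forall>x\<in>S. (f has_derivative blinfun_apply (f' x)) (at x)" "C1_on S f'"
    "\<forall>x\<in>S. (g has_derivative blinfun_apply (g' x)) (at x)" "C1_on S g'"
    using assms unfolding C2_on_def by blast
  then show ?thesis
    unfolding C2_on_def
    by (intro exI[of _ "\<lambda>x. f' x + g' x"])
      (auto simp: plus_blinfun.rep_eq intro!: has_derivative_add C1_on_add)
qed

lemma C2_on_sum:
  assumes "\<And>i. i \<in> I \<Longrightarrow> C2_on S (f i)"
  shows "C2_on S (\<lambda>x. \<Sum>i\<in>I. f i x)"
  using assms by (induction I rule: infinite_finite_induct) (auto simp: C2_on_const C2_on_add)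

text \<open>The product-rule derivative is a sum of products of C1 maps, with
  \<open>blinfun_compose\<close> as the product, so \<open>C1_on_prod\<close> applies to it.\<close>

lemma (in bounded_bilinear) C2_on_prod:
  assumes "C2_on S f" "C2_on S g"
  shows "C2_on S (\<lambda>x. prod (f x) (g x))"
proof -
  obtain f' g' where f': "\<forall>x\<in>S. (f has_derivative blinfun_apply (f' x)) (at x)" "C1_on S f'"
    and g': "\<forall>x\<in>S. (g has_derivative blinfun_apply (g' x)) (at x)" "C1_on S g'"
    using assms unfolding C2_on_def by blast
  note C1 = assms[THEN C2_on_imp_C1_on]
  show ?thesis
    unfolding C2_on_def
  proof (intro exI conjI ballI)
    fix x assume "x \<in> S"
    then show "((\<lambda>x. prod (f x) (g x)) has_derivative
        blinfun_apply ((prod_right (f x) o\<^sub>L g' x) + (prod_left (g x) o\<^sub>L f' x))) (at x)"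
      using FDERIV[of f "blinfun_apply (f' x)" x UNIV g "blinfun_apply (g' x)"] f' g'
      by (auto simp: plus_blinfun.rep_eq blinfun_compose.rep_eq prod_left.rep_eq prod_right.rep_eq)
  next
    show "C1_on S (\<lambda>x. (prod_right (f x) o\<^sub>L g' x) + (prod_left (g x) o\<^sub>L f' x))"
      by (intro C1_on_add bounded_bilinear.C1_on_prod[OF bounded_bilinear_blinfun_compose]
          C1_on_linear_comp[OF bounded_linear_prod_right]
          C1_on_linear_comp[OF bounded_linear_prod_left] f' g' C1)
  qed
qed

lemma C2_on_linear_comp:
  assumes "bounded_linear F" "C2_on S f"
  shows "C2_on S (\<lambda>x. F (f x))"
proof -
  obtain f' where f': "\<forall>x\<in>S. (f has_derivative blinfun_apply (f' x)) (at x)" "C1_on S f'"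
    using assms unfolding C2_on_def by blast
  have "((\<lambda>x. F (f x)) has_derivative blinfun_apply (Blinfun F o\<^sub>L f' x)) (at x)" if "x \<in> S" for x
    using bounded_linear.has_derivative[OF assms(1)] f' that
    by (auto simp: blinfun_compose.rep_eq o_def bounded_linear_Blinfun_apply[OF assms(1)])
  moreover have "C1_on S (\<lambda>x. Blinfun F o\<^sub>L f' x)"
    by (intro bounded_bilinear.C1_on_prod[OF bounded_bilinear_blinfun_compose] C1_on_const f')
  ultimately show ?thesis
    unfolding C2_on_def by (intro exI[of _ "\<lambda>x. Blinfun F o\<^sub>L f' x"] conjI ballI)
qed

lemma bounded_linear_axis:
  "bounded_linear (axis i :: 'a::euclidean_space \<Rightarrow> 'a ^ 'n::finite)"
  unfolding linear_conv_bounded_linear[symmetric]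
  by (rule linearI) (auto simp: vec_eq_iff axis_def)

lemma vec_lambda_eq_sum_axis:
  "(\<chi> i. f i) = (\<Sum>i\<in>UNIV. axis i (f i))"
  by (simp add: vec_eq_iff axis_def)

lemma C2_on_vec:
  assumes "\<And>i. C2_on S (f i)"
  shows "C2_on S (\<lambda>x. (\<chi> i. f i x) :: 'a::euclidean_space ^ 'n::finite)"
  unfolding vec_lambda_eq_sum_axis
  by (intro C2_on_sum C2_on_linear_comp[OF bounded_linear_axis] assms)

text \<open>Openness turns equality on \<open>S\<close> into equality near each of its points, so
  \<open>f\<close> inherits the derivative of \<open>g\<close>. This is how a ReLU network is
  replaced by a polynomial formula where its activation pattern is fixed.\<close>

lemma C2_on_cong:
  assumes "open S" "\<And>x. x \<in> S \<Longrightarrow> f x = g x" "C2_on S g"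
  shows "C2_on S f"
proof -
  obtain g' where g': "\<forall>x\<in>S. (g has_derivative blinfun_apply (g' x)) (at x)" "C1_on S g'"
    using assms unfolding C2_on_def by blast
  have "(f has_derivative blinfun_apply (g' x)) (at x)" if "x \<in> S" for x
    using g' that has_derivative_transform_within_open[of g "blinfun_apply (g' x)" x UNIV S f]
      assms by auto
  with g'(2) show ?thesis
    unfolding C2_on_def by blast
qed

section \<open>Traces and kernels\<close>

lemma C2_on_imp_has_derivative:
  assumes "C2_on S f" "x \<in> S"
  obtains D where "(f has_derivative D) (at x)"
  using assms unfolding C2_on_def by blast

lemma has_derivative_imp_GDERIV:
  fixes f :: "'a::euclidean_space \<Rightarrow> real"
  assumes "(f has_derivative D) (at x)"
  shows "GDERIV f x :> grad f x" "inner h (grad f x) = D h"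
proof -
  interpret D: bounded_linear D
    using assms by (rule has_derivative_bounded_linear)
  have D: "h \<bullet> (\<Sum>b\<in>Basis. D b *\<^sub>R b) = D h" for h
  proof -
    have "D h = D (\<Sum>b\<in>Basis. (h \<bullet> b) *\<^sub>R b)"
      by (simp add: euclidean_representation)
    then show ?thesis
      by (simp add: D.sum D.scaleR inner_sum_right mult.commute)
  qed
  then have *: "GDERIV f x :> (\<Sum>b\<in>Basis. D b *\<^sub>R b)"
    unfolding gderiv_def using assms by (simp add: inner_commute)
  then show "GDERIV f x :> grad f x" "inner h (grad f x) = D h"
    using D by (simp_all add: grad_eqI)
qed

text \<open>Split \<open>s\<close> into its projection \<open>y\<close> to \<open>span T\<close> and
  a remainder \<open>z\<close> orthogonal to \<open>span T\<close>. The assumption makes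
  \<open>z\<close> orthogonal to \<open>s\<close> as well, hence to itself, so \<open>s = y\<close>.
  Inclusions of traces thus become inclusions of kernels.\<close>

lemma span_mono_orthogonal:
  fixes S T :: "'a::euclidean_space set"
  assumes "\<And>h. (\<And>t. t \<in> T \<Longrightarrow> h \<bullet> t = 0) \<Longrightarrow> (\<And>s. s \<in> S \<Longrightarrow> h \<bullet> s = 0)"
  shows "span S \<subseteq> span T"
proof (rule span_minimal)
  show "S \<subseteq> span T"
  proof
    fix s assume "s \<in> S"
    obtain y z where y: "y \<in> span T" and z: "\<And>w. w \<in> span T \<Longrightarrow> orthogonal z w" and s: "s = y + z"
      using orthogonal_subspace_decomp_exists[of T s] by blast
    have "z \<bullet> s = 0"
      using assms[of z s] z \<open>s \<in> S\<close> by (auto simp: orthogonal_def span_base)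
    moreover have "z \<bullet> y = 0"
      using z y by (simp add: orthogonal_def)
    ultimately show "s \<in> span T"
      using s y by (simp add: inner_add_right)
  qed
qed simp

text \<open>Pairing \<open>h\<close> with a combination of the coordinate gradients gives the
  pairing of \<open>D h\<close> with the vector of coefficients; taking \<open>D h\<close> itself as
  that vector yields its squared norm.\<close>

lemma orthogonal_trace_W_of:
  fixes \<phi> :: "'a::euclidean_space \<Rightarrow> 'b::euclidean_space"
  assumes "(\<phi> has_derivative D) (at \<theta>)"
  shows "(\<forall>t\<in>{F \<theta> | F. F \<in> W_of \<phi>}. h \<bullet> t = 0) \<longleftrightarrow> D h = 0"
proof -
  have "((\<lambda>\<theta>. \<phi> \<theta> \<bullet> b) has_derivative (\<lambda>h. D h \<bullet> b)) (at \<theta>)" for b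
    using assms by (auto intro!: derivative_eq_intros)
  from has_derivative_imp_GDERIV(2)[OF this]
  have *: "h \<bullet> (\<Sum>b\<in>Basis. c b *\<^sub>R grad (\<lambda>\<theta>. \<phi> \<theta> \<bullet> b) \<theta>) = D h \<bullet> (\<Sum>b\<in>Basis. c b *\<^sub>R b)" for c
    by (simp add: inner_sum_right)
  show ?thesis
  proof
    assume L: "\<forall>t\<in>{F \<theta> | F. F \<in> W_of \<phi>}. h \<bullet> t = 0"
    have "h \<bullet> (\<Sum>b\<in>Basis. c b *\<^sub>R grad (\<lambda>\<theta>. \<phi> \<theta> \<bullet> b) \<theta>) = 0" for c
      using L by (auto simp: W_of_def)
    with *[of "\<lambda>b. D h \<bullet> b"] show "D h = 0"
      by (simp add: euclidean_representation)
  next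
    assume "D h = 0"
    with * show "\<forall>t\<in>{F \<theta> | F. F \<in> W_of \<phi>}. h \<bullet> t = 0"
      by (auto simp: W_of_def)
  qed
qed

lemma emp_loss_has_derivative:
  fixes l :: "'z::euclidean_space \<Rightarrow> 'y \<Rightarrow> real"
  assumes "\<And>y. C2_on UNIV (\<lambda>z. l z y)"
    and "\<forall>(x, y)\<in>set ds. ((\<lambda>\<theta>. g \<theta> x) has_derivative D x) (at \<theta>)"
  shows "(emp_loss l g ds has_derivative
    (\<lambda>h. \<Sum>(x, y)\<leftarrow>ds. D x h \<bullet> grad (\<lambda>z. l z y) (g \<theta> x))) (at \<theta>)"
  using assms(2)
proof (induction ds)
  case Nil
  then show ?case by (simp add: emp_loss_def[abs_def])
next
  case (Cons d ds)
  obtain x y where d: "d = (x, y)" by force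
  obtain L where "((\<lambda>z. l z y) has_derivative L) (at (g \<theta> x))"
    using C2_on_imp_has_derivative[OF assms(1)] by blast
  then have "((\<lambda>z. l z y) has_derivative (\<lambda>h. h \<bullet> grad (\<lambda>z. l z y) (g \<theta> x))) (at (g \<theta> x))"
    using has_derivative_imp_GDERIV(1) by (simp add: gderiv_def)
  then have "((\<lambda>\<theta>. l (g \<theta> x) y) has_derivative (\<lambda>h. D x h \<bullet> grad (\<lambda>z. l z y) (g \<theta> x))) (at \<theta>)"
    using has_derivative_compose[of "\<lambda>\<theta>. g \<theta> x" "D x" \<theta> UNIV "\<lambda>z. l z y"] Cons.prems
    by (simp add: d)
  from has_derivative_add[OF this Cons.IH] Cons.prems show ?case
    by (simp add: emp_loss_def[abs_def] d)
qed

text \<open>The two inclusions are decoupled. For the first the neighbourhood is arbitrary, so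
  \<open>ker\<close> speaks of every input at which the model is differentiable. For the second it
  suffices to exhibit one neighbourhood \<open>\<Omega>\<close> and one set \<open>X\<close> of
  inputs whose derivatives jointly detect the kernel of \<open>D\<phi>\<close>.\<close>

lemma W_at_eq_traceI:
  fixes l :: "'z::euclidean_space \<Rightarrow> 'y \<Rightarrow> real"
    and g :: "'a::euclidean_space \<Rightarrow> 'x \<Rightarrow> 'z"
    and \<phi> :: "'a \<Rightarrow> 'b::euclidean_space"
  assumes l: "\<And>y. C2_on UNIV (\<lambda>z. l z y)" "\<And>z. span {grad (\<lambda>z. l z y) z | y. True} = UNIV"
    and \<phi>: "(\<phi> has_derivative D\<phi>) (at \<theta>)"
    and ker: "\<And>x D h. ((\<lambda>\<theta>. g \<theta> x) has_derivative D) (at \<theta>) \<Longrightarrow> D\<phi> h = 0 \<Longrightarrow> D h = 0"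
    and \<Omega>: "open \<Omega>" "\<Omega> \<subseteq> \<Theta>" "\<theta> \<in> \<Omega>"
    and X: "\<And>x. x \<in> X \<Longrightarrow> C2_on \<Omega> (\<lambda>\<theta>. g \<theta> x)"
    and sep: "\<And>h. (\<And>x D. x \<in> X \<Longrightarrow> ((\<lambda>\<theta>. g \<theta> x) has_derivative D) (at \<theta>) \<Longrightarrow> D h = 0) \<Longrightarrow> D\<phi> h = 0"
  shows "W_at \<Theta> l g \<theta> = trace_at (W_of \<phi>) \<theta>"
proof
  have "trace_at (W_on l g U) \<theta> \<subseteq> trace_at (W_of \<phi>) \<theta>" if "\<theta> \<in> U" for U
    unfolding trace_at_def
  proof (rule span_mono_orthogonal)
    fix h s
    assume h: "\<And>t. t \<in> {F \<theta> |F. F \<in> W_of \<phi>} \<Longrightarrow> h \<bullet> t = 0"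
      and "s \<in> {F \<theta> |F. F \<in> W_on l g U}"
    then obtain ds where s: "s = grad (emp_loss l g ds) \<theta>"
      and ds: "\<forall>(x, y)\<in>set ds. C2_on U (\<lambda>\<theta>. g \<theta> x)"
      using \<open>\<theta> \<in> U\<close> by (auto simp: W_on_def)
    define D where "D x = (SOME D. ((\<lambda>\<theta>. g \<theta> x) has_derivative D) (at \<theta>))" for x
    have D: "((\<lambda>\<theta>. g \<theta> x) has_derivative D x) (at \<theta>)" if "(x, y) \<in> set ds" for x y
    proof -
      have "C2_on U (\<lambda>\<theta>. g \<theta> x)"
        using ds that by auto
      then have "\<exists>D. ((\<lambda>\<theta>. g \<theta> x) has_derivative D) (at \<theta>)"
        by (rule C2_on_imp_has_derivative[OF _ \<open>\<theta> \<in> U\<close>]) (rule exI)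
      then show ?thesis
        unfolding D_def by (rule someI_ex)
    qed
    have "D\<phi> h = 0"
      using h by (intro orthogonal_trace_W_of[OF \<phi>, THEN iffD1] ballI)
    then have "D x h = 0" if "(x, y) \<in> set ds" for x y
      using ker[OF D[OF that]] by simp
    then have "(\<lambda>(x, y). D x h \<bullet> grad (\<lambda>z. l z y) (g \<theta> x)) d = 0" if "d \<in> set ds" for d
      using that by (cases d) auto
    then have *: "(\<Sum>(x, y)\<leftarrow>ds. D x h \<bullet> grad (\<lambda>z. l z y) (g \<theta> x)) = 0"
      by (subst map_cong[of ds ds _ "\<lambda>_. 0"]) simp_all
    have "(emp_loss l g ds has_derivative
        (\<lambda>h. \<Sum>(x, y)\<leftarrow>ds. D x h \<bullet> grad (\<lambda>z. l z y) (g \<theta> x))) (at \<theta>)"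
      using D by (intro emp_loss_has_derivative l) auto
    from has_derivative_imp_GDERIV(2)[OF this] * show "h \<bullet> s = 0"
      by (simp add: s)
  qed
  then show "W_at \<Theta> l g \<theta> \<subseteq> trace_at (W_of \<phi>) \<theta>"
    unfolding W_at_def by (intro Union_least) auto
next
  have "trace_at (W_of \<phi>) \<theta> \<subseteq> trace_at (W_on l g \<Omega>) \<theta>"
    unfolding trace_at_def
  proof (rule span_mono_orthogonal)
    fix h s
    assume h: "\<And>t. t \<in> {F \<theta> |F. F \<in> W_on l g \<Omega>} \<Longrightarrow> h \<bullet> t = 0"
      and s: "s \<in> {F \<theta> |F. F \<in> W_of \<phi>}"
    have "D\<phi> h = 0"
    proof (rule sep)
      fix x D assume x: "x \<in> X" and D: "((\<lambda>\<theta>. g \<theta> x) has_derivative D) (at \<theta>)"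
      \<comment> \<open>Data sets with a single pair suffice: varying \<open>y\<close> pairs
        \<open>D h\<close> with a spanning set of loss gradients, which makes \<open>D h\<close>
        orthogonal to itself.\<close>
      have "D h \<bullet> grad (\<lambda>z. l z y) (g \<theta> x) = 0" for y
      proof -
        have "(emp_loss l g [(x, y)] has_derivative
            (\<lambda>h. \<Sum>(x, y)\<leftarrow>[(x, y)]. D h \<bullet> grad (\<lambda>z. l z y) (g \<theta> x))) (at \<theta>)"
          using D by (intro emp_loss_has_derivative l) auto
        then have "h \<bullet> grad (emp_loss l g [(x, y)]) \<theta> = D h \<bullet> grad (\<lambda>z. l z y) (g \<theta> x)"
          by (simp add: has_derivative_imp_GDERIV(2))
        moreover have "restrict (grad (emp_loss l g [(x, y)])) \<Omega> \<in> W_on l g \<Omega>"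
          unfolding W_on_def using X[OF x] by (intro CollectI exI[of _ "[(x, y)]"]) simp
        then have "restrict (grad (emp_loss l g [(x, y)])) \<Omega> \<theta> \<in> {F \<theta> |F. F \<in> W_on l g \<Omega>}"
          by (intro CollectI exI[of _ "restrict (grad (emp_loss l g [(x, y)])) \<Omega>"] conjI refl)
        then have "h \<bullet> restrict (grad (emp_loss l g [(x, y)])) \<Omega> \<theta> = 0"
          by (rule h)
        ultimately show ?thesis
          using \<Omega> by simp
      qed
      then have *: "orthogonal (D h) t" if "t \<in> {grad (\<lambda>z. l z y) (g \<theta> x) | y. True}" for t
        using that by (auto simp: orthogonal_def)
      have "D h \<in> span {grad (\<lambda>z. l z y) (g \<theta> x) | y. True}"
        unfolding l(2) by (rule UNIV_I)
      from orthogonal_to_span[OF this *] have "orthogonal (D h) (D h)" .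
      then show "D h = 0"
        by (simp add: orthogonal_def)
    qed
    with s show "h \<bullet> s = 0"
      using orthogonal_trace_W_of[OF \<phi>, THEN iffD2, THEN bspec] by simp
  qed
  also have "\<dots> \<subseteq> W_at \<Theta> l g \<theta>"
    unfolding W_at_def using \<Omega> by (intro Union_upper) auto
  finally show "trace_at (W_of \<phi>) \<theta> \<subseteq> W_at \<Theta> l g \<theta>" .
qed

section \<open>Linear networks\<close>

lemma C2_on_mat_prod:
  "C2_on UNIV (\<lambda>\<theta>::real^'p::finite. mat_prod dims (\<lambda>i j k. \<theta> $ pos (i, j, k)) q j k)"
proof (induction q arbitrary: j k)
  case 0
  show ?case by (simp add: C2_on_const)
next
  case (Suc q)
  show ?case
    by (simp, intro C2_on_sum bounded_bilinear.C2_on_prod[OF bounded_bilinear_mult] Suc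
        C2_on_bounded_linear bounded_linear_vec_nth)
qed

lemma bounded_linear_matrix_vector_left: "bounded_linear (\<lambda>A::real^'m^'n. A *v x)"
  unfolding linear_conv_bounded_linear[symmetric]
  by (rule linearI) (simp_all add: matrix_vector_mult_add_rdistrib scaleR_matrix_vector_assoc)

lemma W_at_lin_net:
  fixes l :: "real^'n::finite \<Rightarrow> 'y \<Rightarrow> real"
  assumes l: "\<And>y. C2_on UNIV (\<lambda>z. l z y)" "\<And>z. span {grad (\<lambda>z. l z y) z | y. True} = UNIV"
  shows "W_at UNIV l (lin_net q dims out_ix in_ix pos) \<theta>
    = trace_at (W_of (lin_phi q dims out_ix (in_ix :: 'm::finite \<Rightarrow> nat) pos)) \<theta>"
proof -
  let ?\<phi> = "lin_phi q dims out_ix in_ix pos"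
  have C2: "C2_on UNIV ?\<phi>"
    unfolding lin_phi_def[abs_def] by (intro C2_on_vec C2_on_mat_prod)
  then obtain D where D: "(?\<phi> has_derivative D) (at \<theta>)"
    by (rule C2_on_imp_has_derivative) simp
  have net: "((\<lambda>\<theta>. lin_net q dims out_ix in_ix pos \<theta> x) has_derivative (\<lambda>h. D h *v x)) (at \<theta>)" for x
    unfolding lin_net_def
    by (rule bounded_linear.has_derivative[OF bounded_linear_matrix_vector_left D])
  show ?thesis
  \<comment> \<open>For every input the network is C2 in the parameters on the whole space.
    Separation holds because a matrix that annihilates all vectors is zero.\<close>
  proof (rule W_at_eq_traceI[OF l D, where \<Omega> = UNIV and X = UNIV])
    fix x E h assume "((\<lambda>\<theta>. lin_net q dims out_ix in_ix pos \<theta> x) has_derivative E) (at \<theta>)" "D h = 0"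
    then show "E h = 0"
      using has_derivative_unique[OF net, of x E] by (metis matrix_vector_mult_0)
  next
    fix h
    assume *: "\<And>x E. x \<in> UNIV \<Longrightarrow>
      ((\<lambda>\<theta>. lin_net q dims out_ix in_ix pos \<theta> x) has_derivative E) (at \<theta>) \<Longrightarrow> E h = 0"
    have "D h *v x = 0 *v x" for x
      using *[OF _ net] by simp
    then show "D h = 0"
      by (intro matrix_eq[THEN iffD2] allI)
  next
    show "C2_on UNIV (\<lambda>\<theta>. lin_net q dims out_ix in_ix pos \<theta> x)" for x
      unfolding lin_net_def by (rule C2_on_linear_comp[OF bounded_linear_matrix_vector_left C2])
  qed auto
qed

section \<open>Two-layer ReLU networks\<close>

text \<open>Networks with and without biases are both instances.  The last assumption says that each
  preactivation can be varied separately, with everything else held fixed, unless it vanishes for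
  all parameters; the latter happens for \<open>x = 0\<close> in the absence of biases.\<close>

locale relu_model =
  fixes u :: "'r::finite \<Rightarrow> 'a::euclidean_space \<Rightarrow> 'z::euclidean_space"
    and v :: "'r \<Rightarrow> 'a \<Rightarrow> 'x::euclidean_space"
    and b :: "'r \<Rightarrow> 'a \<Rightarrow> real"
    and c :: "'a \<Rightarrow> 'z"
  assumes bounded_linear_u: "bounded_linear (u j)"
    and bounded_linear_v: "bounded_linear (v j)"
    and bounded_linear_b: "bounded_linear (b j)"
    and bounded_linear_c: "bounded_linear c"
    and isolate: "(\<forall>\<theta>. v j \<theta> \<bullet> x + b j \<theta> = 0) \<or>
      (\<exists>d. v j d \<bullet> x + b j d \<noteq> 0 \<and> (\<forall>i. i \<noteq> j \<longrightarrow> v i d \<bullet> x + b i d = 0) \<and>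
        (\<forall>i. u i d = 0) \<and> c d = 0)"
begin

definition pre :: "'r \<Rightarrow> 'x \<Rightarrow> 'a \<Rightarrow> real" where
  "pre j x \<theta> = v j \<theta> \<bullet> x + b j \<theta>"

definition net :: "'a \<Rightarrow> 'x \<Rightarrow> 'z" where
  "net \<theta> x = (\<Sum>j\<in>UNIV. relu (pre j x \<theta>) *\<^sub>R u j \<theta>) + c \<theta>"

definition admissible :: "'a set" where
  "admissible = {\<theta>. (\<forall>j. v j \<theta> \<noteq> 0) \<and>
     (\<forall>i j. i \<noteq> j \<longrightarrow> {x. pre i x \<theta> = 0} \<noteq> {x. pre j x \<theta> = 0})}"

text \<open>The slope of \<open>relu\<close>, set to 0 at the kink. In the kink cases of
  \<open>has_derivative_relu_term\<close> also \<open>dterm\<close> vanishes, in agreement with the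
  zero derivative there.\<close>

definition act :: "'r \<Rightarrow> 'x \<Rightarrow> 'a \<Rightarrow> real" where
  "act j x \<theta> = (if 0 < pre j x \<theta> then 1 else 0)"

text \<open>The derivative at \<open>\<theta>\<close> in direction \<open>h\<close> of the
  contribution of an active neuron, read as an affine map of the input \<open>x\<close>.\<close>

definition dterm :: "'a \<Rightarrow> 'a \<Rightarrow> 'r \<Rightarrow> 'x \<Rightarrow> 'z" where
  "dterm \<theta> h j x = pre j x \<theta> *\<^sub>R u j h + pre j x h *\<^sub>R u j \<theta>"

lemma bounded_linear_pre: "bounded_linear (pre j x)"
  unfolding pre_def[abs_def]
  by (intro bounded_linear_add bounded_linear_b
      bounded_linear_compose[OF bounded_linear_inner_left bounded_linear_v])

lemma pre_add: "pre j (x + w) \<theta> = pre j x \<theta> + v j \<theta> \<bullet> w"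
  by (simp add: pre_def inner_add_right)

lemma pre_line: "pre j (p + t *\<^sub>R (x - p)) \<theta> = (1 - t) * pre j p \<theta> + t * pre j x \<theta>"
  by (simp add: pre_def inner_add_right inner_diff_right algebra_simps)

lemma dterm_line:
  "dterm \<theta> h j (p + t *\<^sub>R (x - p)) = (1 - t) *\<^sub>R dterm \<theta> h j p + t *\<^sub>R dterm \<theta> h j x"
  unfolding dterm_def pre_line by (simp add: algebra_simps)

section \<open>Differentiability of the network in its parameters\<close>

lemma has_derivative_pre_scaleR:
  "((\<lambda>\<theta>. pre j x \<theta> *\<^sub>R u j \<theta>) has_derivative (\<lambda>h. dterm \<theta> h j x)) (at \<theta>)"
  unfolding dterm_def
  by (intro has_derivative_scaleR bounded_linear_imp_has_derivative bounded_linear_pre bounded_linear_u)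

lemma isCont_pre: "isCont (pre j x) \<theta>"
  by (intro linear_continuous_at bounded_linear_pre)

lemma isCont_v: "isCont (v j) \<theta>"
  by (intro linear_continuous_at bounded_linear_v)

lemma continuous_on_pre: "continuous_on S (pre j x)"
  by (intro linear_continuous_on bounded_linear_pre)

text \<open>Away from the kink the sign of \<open>pre j x\<close> is locally constant, so the term
  is locally a product of linear maps or zero. At a kink with \<open>u j \<theta> = 0\<close> both
  factors are of first order in the distance to \<open>\<theta>\<close>; their product is of second
  order and has derivative zero.\<close>

lemma has_derivative_relu_term:
  assumes "pre j x \<theta> \<noteq> 0 \<or> u j \<theta> = 0 \<or> (\<forall>\<theta>. pre j x \<theta> = 0)"
  shows "((\<lambda>\<theta>. relu (pre j x \<theta>) *\<^sub>R u j \<theta>) has_derivative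
    (\<lambda>h. act j x \<theta> *\<^sub>R dterm \<theta> h j x)) (at \<theta>)"
proof -
  consider "pre j x \<theta> > 0" | "pre j x \<theta> < 0" | "\<forall>\<theta>. pre j x \<theta> = 0" | "pre j x \<theta> = 0" "u j \<theta> = 0"
    using assms by (metis linorder_neqE_linordered_idom)
  then show ?thesis
  proof cases
    case 1
    have "open {\<theta>. pre j x \<theta> > 0}"
      by (intro open_Collect_less continuous_on_const continuous_on_pre)
    from has_derivative_transform_within_open[OF has_derivative_pre_scaleR this]
    show ?thesis
      using 1 by (simp add: act_def relu_def)
  next
    case 2
    have "open {\<theta>. pre j x \<theta> < 0}"
      by (intro open_Collect_less continuous_on_const continuous_on_pre)
    then have "((\<lambda>\<theta>. relu (pre j x \<theta>) *\<^sub>R u j \<theta>) has_derivative (\<lambda>h. 0)) (at \<theta>)"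
      by (rule has_derivative_transform_within_open[OF has_derivative_const[of 0]])
        (use 2 in \<open>auto simp: relu_def\<close>)
    then show ?thesis
      using 2 by (simp add: act_def)
  next
    case 3
    then show ?thesis by (simp add: act_def relu_def)
  next
    case 4
    obtain K where K: "\<And>y. norm (pre j x y) \<le> norm y * K"
      using bounded_linear.bounded[OF bounded_linear_pre] by blast
    obtain L where L: "\<And>y. norm (u j y) \<le> norm y * L"
      using bounded_linear.bounded[OF bounded_linear_u] by blast
    have "((\<lambda>\<theta>. relu (pre j x \<theta>) *\<^sub>R u j \<theta>) has_derivative (\<lambda>h. 0)) (at \<theta>)"
    proof (rule has_derivativeI_sandwich[where e = 1])
      fix y assume "y \<noteq> \<theta>"
      have "\<bar>relu (pre j x y)\<bar> \<le> \<bar>pre j x (y - \<theta>)\<bar>"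
        using 4 by (simp add: relu_def linear_diff[OF bounded_linear.linear[OF bounded_linear_pre]])
      also have "\<dots> \<le> norm (y - \<theta>) * K"
        using K[of "y - \<theta>"] by simp
      finally have 1: "\<bar>relu (pre j x y)\<bar> \<le> norm (y - \<theta>) * K" .
      have 2: "norm (u j y) \<le> norm (y - \<theta>) * L"
        using L[of "y - \<theta>"] 4 by (simp add: linear_diff[OF bounded_linear.linear[OF bounded_linear_u]])
      have "norm (relu (pre j x y) *\<^sub>R u j y) \<le> (norm (y - \<theta>) * K) * (norm (y - \<theta>) * L)"
        unfolding norm_scaleR by (intro mult_mono' 1 2) auto
      then show "norm (relu (pre j x y) *\<^sub>R u j y - relu (pre j x \<theta>) *\<^sub>R u j \<theta> - 0) / norm (y - \<theta>)
          \<le> norm (y - \<theta>) * (K * L)"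
        using 4 \<open>y \<noteq> \<theta>\<close> by (simp add: divide_simps ac_simps)
    next
      have "((\<lambda>y. norm (y - \<theta>) * (K * L)) \<longlongrightarrow> norm (\<theta> - \<theta>) * (K * L)) (at \<theta>)"
        by (intro tendsto_intros)
      then show "((\<lambda>y. norm (y - \<theta>) * (K * L)) \<longlongrightarrow> 0) (at \<theta>)"
        by simp
    qed auto
    with 4 show ?thesis
      by (simp add: act_def)
  qed
qed

lemma has_derivative_net:
  assumes "\<And>j. pre j x \<theta> \<noteq> 0 \<or> u j \<theta> = 0 \<or> (\<forall>\<theta>. pre j x \<theta> = 0)"
  shows "((\<lambda>\<theta>. net \<theta> x) has_derivative
    (\<lambda>h. (\<Sum>j\<in>UNIV. act j x \<theta> *\<^sub>R dterm \<theta> h j x) + c h)) (at \<theta>)"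
  unfolding net_def
  by (intro has_derivative_add has_derivative_sum has_derivative_relu_term assms
      bounded_linear_imp_has_derivative bounded_linear_c)

text \<open>Moving along the direction given by \<open>isolate\<close> turns the symmetric second difference of
  the network into a multiple of \<open>\<bar>t\<bar>\<close>.\<close>

lemma net_differentiable_imp:
  assumes D: "((\<lambda>\<theta>. net \<theta> x) has_derivative D) (at \<theta>)"
  shows "pre j x \<theta> \<noteq> 0 \<or> u j \<theta> = 0 \<or> (\<forall>\<theta>. pre j x \<theta> = 0)"
proof (rule ccontr)
  assume "\<not> ?thesis"
  then have p: "pre j x \<theta> = 0" and u: "u j \<theta> \<noteq> 0" and "\<not> (\<forall>\<theta>. pre j x \<theta> = 0)"
    by auto
  then obtain d where d: "pre j x d \<noteq> 0" "\<And>i. i \<noteq> j \<Longrightarrow> pre i x d = 0"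
    "\<And>i. u i d = 0" "c d = 0"
    using isolate[of j x] by (auto simp: pre_def)
  interpret D: bounded_linear D
    using D by (rule has_derivative_bounded_linear)
  \<comment> \<open>Adding the values at opposite displacements cancels the linear part, so
    differentiability of the network gives \<open>k\<close> the derivative 0.\<close>
  define k where "k t = net (\<theta> + t *\<^sub>R d) x + net (\<theta> + (- t) *\<^sub>R d) x" for t :: real
  have line: "((\<lambda>t. net (\<theta> + (s * t) *\<^sub>R d) x) has_derivative (\<lambda>t. D ((s * t) *\<^sub>R d))) (at 0)" for s :: real
    by (rule has_derivative_compose[where g = "\<lambda>\<theta>. net \<theta> x"])
      (auto intro!: derivative_eq_intros D)
  have "(k has_derivative (\<lambda>t. 0)) (at 0)"
    using has_derivative_add[OF line[of 1] line[of "-1"]]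
    by (simp add: k_def[abs_def] D.neg)
  then have lim: "((\<lambda>t. norm (k t - k 0) / norm t) \<longlongrightarrow> 0) (at 0)"
    by (simp add: has_derivative_at)
  have net: "net (\<theta> + t *\<^sub>R d) x = (\<Sum>i\<in>UNIV. relu (pre i x \<theta> + t * pre i x d) *\<^sub>R u i \<theta>) + c \<theta>" for t
    using d(3,4)
    by (simp add: net_def linear_add[OF bounded_linear.linear] linear_cmul[OF bounded_linear.linear]
        bounded_linear_pre bounded_linear_u bounded_linear_c)
  have relu: "relu s + relu (- s) = \<bar>s\<bar>" for s
    by (simp add: relu_def)
  have k: "k t - k 0 = (\<bar>t\<bar> * \<bar>pre j x d\<bar>) *\<^sub>R u j \<theta>" for t
  proof -
    have "k t - k 0 = (\<Sum>i\<in>UNIV. (relu (pre i x \<theta> + t * pre i x d) + relu (pre i x \<theta> + (- t) * pre i x d)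
        - relu (pre i x \<theta>) - relu (pre i x \<theta>)) *\<^sub>R u i \<theta>)"
      unfolding k_def net
      by (simp add: scaleR_add_left scaleR_diff_left sum.distrib sum_subtractf)
        (simp add: scaleR_2 sum.distrib flip: scaleR_scaleR)
    also have "\<dots> = (\<Sum>i\<in>UNIV. if i = j then (\<bar>t\<bar> * \<bar>pre j x d\<bar>) *\<^sub>R u j \<theta> else 0)"
    proof (rule sum.cong)
      fix i
      show "(relu (pre i x \<theta> + t * pre i x d) + relu (pre i x \<theta> + (- t) * pre i x d) - relu (pre i x \<theta>) - relu (pre i x \<theta>)) *\<^sub>R u i \<theta> =
          (if i = j then (\<bar>t\<bar> * \<bar>pre j x d\<bar>) *\<^sub>R u j \<theta> else 0)"
      proof (cases "i = j")
        case True
        with p show ?thesis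
          using relu[of "t * pre j x d"] by (simp add: abs_mult relu_def[of 0])
      qed (simp add: d(2))
    qed simp
    finally show ?thesis by simp
  qed
  have "norm (k t - k 0) / norm t = \<bar>pre j x d\<bar> * norm (u j \<theta>)" if "t \<noteq> 0" for t
    using that unfolding k by (simp add: abs_mult)
  then have "((\<lambda>t. norm (k t - k 0) / norm t) \<longlongrightarrow> \<bar>pre j x d\<bar> * norm (u j \<theta>)) (at 0)"
    by (intro tendsto_eventually) (auto simp: eventually_at_filter)
  from tendsto_unique[OF _ this lim] show False
    using d(1) u by simp
qed

section \<open>Openness of the set of admissible parameters\<close>

lemma eventually_hyperplane_neq:
  assumes "v i \<theta> \<noteq> 0" "pre i x \<theta> = 0" "pre j x \<theta> \<noteq> 0"
  shows "\<forall>\<^sub>F \<theta>' in nhds \<theta>. {x. pre i x \<theta>' = 0} \<noteq> {x. pre j x \<theta>' = 0}"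
proof -
  have v: "(v k \<longlongrightarrow> v k \<theta>) (nhds \<theta>)" for k
    using isCont_v[of \<theta> k] by (simp add: isCont_def tendsto_at_iff_tendsto_nhds)
  have p: "(pre k x \<longlongrightarrow> pre k x \<theta>) (nhds \<theta>)" for k
    using isCont_pre[of \<theta> k x] by (simp add: isCont_def tendsto_at_iff_tendsto_nhds)
  \<comment> \<open>\<open>x + P \<theta>'\<close> is the orthogonal projection of \<open>x\<close>
    to the hyperplane of neuron \<open>i\<close> at \<open>\<theta>'\<close>. It tends to
    \<open>x\<close>, so for nearby parameters it stays off the hyperplane of neuron
    \<open>j\<close> and tells the two apart.\<close>
  define P where "P \<theta>' = - (pre i x \<theta>' / (v i \<theta>' \<bullet> v i \<theta>')) *\<^sub>R v i \<theta>'" for \<theta>'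
  have "(P \<longlongrightarrow> P \<theta>) (nhds \<theta>)"
    unfolding P_def using assms(1) by (intro tendsto_intros p v) auto
  moreover have "P \<theta> = 0"
    using assms(2) by (simp add: P_def)
  ultimately have "((\<lambda>\<theta>'. pre j x \<theta>' + v j \<theta>' \<bullet> P \<theta>') \<longlongrightarrow> pre j x \<theta> + v j \<theta> \<bullet> 0) (nhds \<theta>)"
    by (intro tendsto_intros p v) simp
  then have "\<forall>\<^sub>F \<theta>' in nhds \<theta>. pre j x \<theta>' + v j \<theta>' \<bullet> P \<theta>' \<noteq> 0"
    using assms(3) by (intro tendsto_imp_eventually_ne) auto
  moreover have "\<forall>\<^sub>F \<theta>' in nhds \<theta>. v i \<theta>' \<noteq> 0"
    using v assms(1) by (intro tendsto_imp_eventually_ne)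
  ultimately show ?thesis
  proof eventually_elim
    case (elim \<theta>')
    have "pre i (x + P \<theta>') \<theta>' = 0"
      using elim(2) unfolding pre_add by (simp add: P_def)
    moreover have "pre j (x + P \<theta>') \<theta>' \<noteq> 0"
      using elim(1) unfolding pre_add .
    ultimately show ?case by blast
  qed
qed

text \<open>Each of the finitely many conditions persists near \<open>\<theta>\<close>: nonvanishing
  by continuity, distinctness because some point lies on one hyperplane and off the other.\<close>

lemma open_admissible: "open admissible"
proof -
  have "\<forall>\<^sub>F \<theta>' in nhds \<theta>. \<theta>' \<in> admissible" if "\<theta> \<in> admissible" for \<theta>
  proof -
    have "\<forall>\<^sub>F \<theta>' in nhds \<theta>. v j \<theta>' \<noteq> 0" for j
    proof (rule tendsto_imp_eventually_ne)
      show "(v j \<longlongrightarrow> v j \<theta>) (nhds \<theta>)"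
        using isCont_v[of \<theta> j] by (simp add: isCont_def tendsto_at_iff_tendsto_nhds)
      show "v j \<theta> \<noteq> 0"
        using that by (simp add: admissible_def)
    qed
    moreover have "\<forall>\<^sub>F \<theta>' in nhds \<theta>. i \<noteq> j \<longrightarrow> {x. pre i x \<theta>' = 0} \<noteq> {x. pre j x \<theta>' = 0}" for i j
    proof (cases "i = j")
      case False
      then have "{x. pre i x \<theta> = 0} \<noteq> {x. pre j x \<theta> = 0}" and ij: "v i \<theta> \<noteq> 0" "v j \<theta> \<noteq> 0"
        using that by (auto simp: admissible_def)
      then consider x where "pre i x \<theta> = 0" "pre j x \<theta> \<noteq> 0" | x where "pre j x \<theta> = 0" "pre i x \<theta> \<noteq> 0"
        by blast
      then have "\<forall>\<^sub>F \<theta>' in nhds \<theta>. {x. pre i x \<theta>' = 0} \<noteq> {x. pre j x \<theta>' = 0}"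
      proof cases
        case 1
        with ij show ?thesis by (intro eventually_hyperplane_neq)
      next
        case 2
        with ij have "\<forall>\<^sub>F \<theta>' in nhds \<theta>. {x. pre j x \<theta>' = 0} \<noteq> {x. pre i x \<theta>' = 0}"
          by (intro eventually_hyperplane_neq)
        then show ?thesis by eventually_elim metis
      qed
      then show ?thesis by eventually_elim simp
    qed simp
    ultimately show ?thesis
      unfolding admissible_def mem_Collect_eq
      by (intro eventually_conj eventually_all_finite)
  qed
  then have "\<exists>T. open T \<and> \<theta> \<in> T \<and> T \<subseteq> admissible" if "\<theta> \<in> admissible" for \<theta>
    using that unfolding eventually_nhds subset_eq by simp
  then show ?thesis
    by (subst open_subopen) simp
qed

section \<open>Hyperplane arrangements and activation patterns\<close>

lemma hyperplane_not_subset: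
  assumes \<theta>: "\<theta> \<in> admissible" and "i \<noteq> j"
  obtains y where "pre j y \<theta> = 0" "pre i y \<theta> \<noteq> 0"
proof (rule ccontr)
  assume "\<not> thesis"
  with that have sub: "pre i y \<theta> = 0" if "pre j y \<theta> = 0" for y
    using that by blast
  have v: "v i \<theta> \<noteq> 0" "v j \<theta> \<noteq> 0" and neq: "{x. pre i x \<theta> = 0} \<noteq> {x. pre j x \<theta> = 0}"
    using assms by (auto simp: admissible_def)
  define y where "y = - (b j \<theta> / (v j \<theta> \<bullet> v j \<theta>)) *\<^sub>R v j \<theta>"
  have y: "pre j y \<theta> = 0"
    using v by (simp add: y_def pre_def)
  define r where "r = (v i \<theta> \<bullet> v j \<theta>) / (v j \<theta> \<bullet> v j \<theta>)"
  \<comment> \<open>The part of \<open>v i \<theta>\<close> orthogonal to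
    \<open>v j \<theta>\<close> is a direction inside the hyperplane of \<open>j\<close>. As that
    hyperplane is assumed to lie in the one of \<open>i\<close>, \<open>w\<close> is orthogonal to
    \<open>v i \<theta>\<close> too and vanishes; the two preactivations are then
    proportional.\<close>
  define w where "w = v i \<theta> - r *\<^sub>R v j \<theta>"
  have w: "v j \<theta> \<bullet> w = 0"
    using v by (simp add: w_def r_def inner_diff_right inner_commute)
  then have "pre i (y + w) \<theta> = 0"
    using y by (intro sub) (simp add: pre_add)
  then have "v i \<theta> \<bullet> w = 0"
    using sub[OF y] by (simp add: pre_add)
  with w have "w \<bullet> w = 0"
    by (simp add: w_def inner_diff_left)
  then have vi: "v i \<theta> = r *\<^sub>R v j \<theta>"
    by (simp add: w_def)
  with v have r: "r \<noteq> 0" by auto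
  have "b i \<theta> = r * b j \<theta>"
  proof -
    have "b j \<theta> = - (v j \<theta> \<bullet> y)"
      using y by (simp add: pre_def)
    moreover have "b i \<theta> = - r * (v j \<theta> \<bullet> y)"
      using sub[OF y] vi by (simp add: pre_def)
    ultimately show ?thesis by simp
  qed
  with vi have "pre i x \<theta> = r * pre j x \<theta>" for x
    by (simp add: pre_def algebra_simps)
  with r neq show False by simp
qed

text \<open>The other neurons are added one at a time. The line through a point \<open>x\<close>
  that is good so far and a point \<open>y\<close> off the new hyperplane stays in the hyperplane of
  \<open>j\<close>. Each neuron rules out at most one parameter on it, so some parameter is good for
  all.\<close>

lemma hyperplane_point:
  assumes \<theta>: "\<theta> \<in> admissible"
  obtains x where "pre j x \<theta> = 0" "\<And>i. i \<noteq> j \<Longrightarrow> pre i x \<theta> \<noteq> 0"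
proof -
  have "\<exists>x. pre j x \<theta> = 0 \<and> (\<forall>i\<in>I. pre i x \<theta> \<noteq> 0)" if "finite I" "j \<notin> I" for I
    using that
  proof (induction I)
    case empty
    have "v j \<theta> \<noteq> 0"
      using \<theta> by (simp add: admissible_def)
    then have "pre j (- (b j \<theta> / (v j \<theta> \<bullet> v j \<theta>)) *\<^sub>R v j \<theta>) \<theta> = 0"
      by (simp add: pre_def)
    then show ?case by blast
  next
    case (insert k I)
    then obtain x where x: "pre j x \<theta> = 0" "\<forall>i\<in>I. pre i x \<theta> \<noteq> 0"
      by auto
    obtain y where y: "pre j y \<theta> = 0" "pre k y \<theta> \<noteq> 0"
      using hyperplane_not_subset[OF \<theta>, of k j] insert.prems by auto
    let ?bad = "\<lambda>i. {t. pre i (x + t *\<^sub>R (y - x)) \<theta> = 0}"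
    have "finite (?bad i)" if "i \<in> insert k I" for i
    proof (rule finite_subset)
      \<comment> \<open>Along the line \<open>pre i\<close> is affine in \<open>t\<close>, with
        values at 0 and 1 that are not both zero; this is its only possible root.\<close>
      show "?bad i \<subseteq> {pre i x \<theta> / (pre i x \<theta> - pre i y \<theta>)}"
      proof
        fix t assume "t \<in> ?bad i"
        then have t: "t * (pre i x \<theta> - pre i y \<theta>) = pre i x \<theta>"
          unfolding mem_Collect_eq pre_line by (simp add: algebra_simps)
        have "pre i x \<theta> \<noteq> 0 \<or> pre i y \<theta> \<noteq> 0"
          using that x(2) y(2) by auto
        with t have "pre i x \<theta> - pre i y \<theta> \<noteq> 0"
          by auto
        with t show "t \<in> {pre i x \<theta> / (pre i x \<theta> - pre i y \<theta>)}"
          by (simp add: field_simps)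
      qed
    qed simp
    then have "finite (\<Union>i\<in>insert k I. ?bad i)"
      using insert.hyps(1) by blast
    then obtain t where "t \<notin> (\<Union>i\<in>insert k I. ?bad i)"
      using ex_new_if_finite[OF infinite_UNIV_char_0] by blast
    then have "\<forall>i\<in>insert k I. pre i (x + t *\<^sub>R (y - x)) \<theta> \<noteq> 0"
      by blast
    moreover have "pre j (x + t *\<^sub>R (y - x)) \<theta> = 0"
      using x(1) y(1) by (simp add: pre_line)
    ultimately show ?case by blast
  qed
  from this[of "UNIV - {j}"] show thesis
    using that by auto
qed

text \<open>Start on the hyperplane of \<open>j\<close> and off all others, and move a short way
  along plus and minus \<open>v j \<theta>\<close>. Neuron \<open>j\<close> gets opposite signs,
  while the others keep theirs by continuity.\<close>

lemma hyperplane_crossing: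
  assumes \<theta>: "\<theta> \<in> admissible"
  obtains p q where "\<And>i. pre i p \<theta> \<noteq> 0" "\<And>i. pre i q \<theta> \<noteq> 0"
    "act j p \<theta> = 1" "act j q \<theta> = 0" "\<And>i. i \<noteq> j \<Longrightarrow> act i p \<theta> = act i q \<theta>"
proof -
  obtain x where x: "pre j x \<theta> = 0" "\<And>i. i \<noteq> j \<Longrightarrow> pre i x \<theta> \<noteq> 0"
    using hyperplane_point[OF \<theta>] by blast
  have v: "v j \<theta> \<bullet> v j \<theta> > 0"
    using \<theta> by (simp add: admissible_def)
  \<comment> \<open>A positive product with the value at \<open>x\<close> encodes an unchanged sign;
    \<open>s\<close> will be 1 and -1 for the two sides.\<close>
  have ev: "\<forall>\<^sub>F t in at_right 0. i \<noteq> j \<longrightarrow> 0 < pre i (x + (s * t) *\<^sub>R v j \<theta>) \<theta> * pre i x \<theta>" for i and s :: real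
  proof (cases "i = j")
    case False
    have "((\<lambda>t. (pre i x \<theta> + v i \<theta> \<bullet> ((s * t) *\<^sub>R v j \<theta>)) * pre i x \<theta>)
        \<longlongrightarrow> (pre i x \<theta> + v i \<theta> \<bullet> ((s * 0) *\<^sub>R v j \<theta>)) * pre i x \<theta>) (at_right 0)"
      by (intro tendsto_intros)
    moreover have "0 < pre i x \<theta> * pre i x \<theta>"
      using x(2)[OF False] not_real_square_gt_zero by blast
    ultimately have "\<forall>\<^sub>F t in at_right 0. 0 < (pre i x \<theta> + v i \<theta> \<bullet> ((s * t) *\<^sub>R v j \<theta>)) * pre i x \<theta>"
      by (intro order_tendstoD(1)) auto
    then show ?thesis
      by eventually_elim (simp add: pre_add)
  qed simp
  have "\<forall>\<^sub>F t in at_right (0::real). 0 < t \<and>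
      (\<forall>i. i \<noteq> j \<longrightarrow> 0 < pre i (x + (1 * t) *\<^sub>R v j \<theta>) \<theta> * pre i x \<theta>) \<and>
      (\<forall>i. i \<noteq> j \<longrightarrow> 0 < pre i (x + (- 1 * t) *\<^sub>R v j \<theta>) \<theta> * pre i x \<theta>)"
    by (intro eventually_conj eventually_all_finite ev eventually_at_right_less)
  then obtain t :: real where t: "0 < t"
    "\<And>i. i \<noteq> j \<Longrightarrow> 0 < pre i (x + (1 * t) *\<^sub>R v j \<theta>) \<theta> * pre i x \<theta>"
    "\<And>i. i \<noteq> j \<Longrightarrow> 0 < pre i (x + (- 1 * t) *\<^sub>R v j \<theta>) \<theta> * pre i x \<theta>"
    using eventually_happens'[OF trivial_limit_at_right_real] by blast
  have j: "pre j (x + (s * t) *\<^sub>R v j \<theta>) \<theta> = s * (t * (v j \<theta> \<bullet> v j \<theta>))" for s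
    using x(1) by (simp add: pre_add)
  have tv: "0 < t * (v j \<theta> \<bullet> v j \<theta>)"
    using t(1) v by simp
  show thesis
  proof (rule that)
    show "pre i (x + (1 * t) *\<^sub>R v j \<theta>) \<theta> \<noteq> 0" for i
      using t(2)[of i] j[of 1] tv by (cases "i = j") auto
    show "pre i (x + (- 1 * t) *\<^sub>R v j \<theta>) \<theta> \<noteq> 0" for i
      using t(3)[of i] j[of "-1"] tv by (cases "i = j") auto
    show "act j (x + (1 * t) *\<^sub>R v j \<theta>) \<theta> = 1"
      unfolding act_def j using tv by simp
    show "act j (x + (- 1 * t) *\<^sub>R v j \<theta>) \<theta> = 0"
      unfolding act_def j using tv by simp
    show "act i (x + (1 * t) *\<^sub>R v j \<theta>) \<theta> = act i (x + (- 1 * t) *\<^sub>R v j \<theta>) \<theta>" if "i \<noteq> j" for i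
      using t(2,3)[OF that] unfolding act_def zero_less_mult_iff by auto
  qed
qed

text \<open>Preactivations are jointly continuous in parameter and input, so keeping the signs is an
  open condition on the pair. It holds at \<open>(\<theta>, p)\<close>, hence on a product of
  neighbourhoods \<open>A\<close> of \<open>\<theta>\<close> and \<open>B\<close> of
  \<open>p\<close>.\<close>

lemma activation_locally_constant:
  assumes "\<And>i. pre i p \<theta> \<noteq> 0"
  obtains A B where "open A" "open B" "\<theta> \<in> A" "p \<in> B"
    "\<And>\<theta>' x i. \<theta>' \<in> A \<Longrightarrow> x \<in> B \<Longrightarrow> pre i x \<theta>' \<noteq> 0 \<and> act i x \<theta>' = act i p \<theta>"
proof -
  have "continuous_on UNIV (\<lambda>z. pre i (snd z) (fst z) * pre i p \<theta>)" for i
    unfolding pre_def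
    by (intro continuous_on_mult continuous_on_add continuous_on_inner continuous_on_snd
        continuous_on_id continuous_on_const bounded_linear.continuous_on[OF bounded_linear_v]
        bounded_linear.continuous_on[OF bounded_linear_b] continuous_on_fst)
  then have "open {z. 0 < pre i (snd z) (fst z) * pre i p \<theta>}" for i
    by (intro open_Collect_less continuous_on_const)
  then have "open (\<Inter>i. {z. 0 < pre i (snd z) (fst z) * pre i p \<theta>})"
    by (intro open_INT) auto
  moreover have "(\<theta>, p) \<in> (\<Inter>i. {z. 0 < pre i (snd z) (fst z) * pre i p \<theta>})"
    using assms by (auto simp: zero_less_mult_iff linorder_neq_iff)
  ultimately obtain A B where AB: "open A" "open B" "(\<theta>, p) \<in> A \<times> B"
    "A \<times> B \<subseteq> (\<Inter>i. {z. 0 < pre i (snd z) (fst z) * pre i p \<theta>})"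
    by (rule open_prod_elim)
  show thesis
  proof (rule that)
    fix \<theta>' x i assume "\<theta>' \<in> A" "x \<in> B"
    then have "0 < pre i x \<theta>' * pre i p \<theta>"
      using subsetD[OF AB(4), of "(\<theta>', x)"] by auto
    then show "pre i x \<theta>' \<noteq> 0 \<and> act i x \<theta>' = act i p \<theta>"
      by (auto simp: act_def zero_less_mult_iff)
  qed (use AB in auto)
qed

text \<open>As \<open>G p = 0\<close>, the value of \<open>G\<close> at
  \<open>p + t *\<^sub>R (x - p)\<close> is \<open>t *\<^sub>R G x\<close>; for small positive
  \<open>t\<close> that point lies in \<open>B\<close>.\<close>

lemma affine_eq_0:
  fixes G :: "'x \<Rightarrow> 'z"
  assumes line: "\<And>t x. G (p + t *\<^sub>R (x - p)) = (1 - t) *\<^sub>R G p + t *\<^sub>R G x"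
    and B: "open B" "p \<in> B" "\<And>x. x \<in> B \<Longrightarrow> G x = 0"
  shows "G x = 0"
proof -
  have "((\<lambda>t. p + t *\<^sub>R (x - p)) \<longlongrightarrow> p + 0 *\<^sub>R (x - p)) (at_right (0::real))"
    by (intro tendsto_intros)
  then have "\<forall>\<^sub>F t in at_right 0. p + t *\<^sub>R (x - p) \<in> B"
    using B(1,2) by (intro topological_tendstoD) auto
  then have "\<forall>\<^sub>F t in at_right (0::real). 0 < t \<and> p + t *\<^sub>R (x - p) \<in> B"
    by (intro eventually_conj eventually_at_right_less)
  then obtain t where "0 < t" "p + t *\<^sub>R (x - p) \<in> B"
    using eventually_happens'[OF trivial_limit_at_right_real] by blast
  with line[of t x] B show ?thesis
    by simp
qed

text \<open>\<open>\<phi>\<close> enters only through the kernel of its derivative, so each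
  parametrization is handled by verifying \<open>ker\<close>.\<close>

theorem W_at_net:
  fixes l :: "'z \<Rightarrow> 'y \<Rightarrow> real" and \<phi> :: "'a \<Rightarrow> 'b::euclidean_space"
  assumes l: "\<And>y. C2_on UNIV (\<lambda>z. l z y)" "\<And>z. span {grad (\<lambda>z. l z y) z | y. True} = UNIV"
    and \<theta>: "\<theta> \<in> admissible"
    and \<phi>: "(\<phi> has_derivative D\<phi>) (at \<theta>)"
    and ker: "\<And>h. D\<phi> h = 0 \<longleftrightarrow> (\<forall>j x. dterm \<theta> h j x = 0) \<and> c h = 0"
  shows "W_at admissible l net \<theta> = trace_at (W_of \<phi>) \<theta>"
proof -
  have "\<exists>p q. (\<forall>i. pre i p \<theta> \<noteq> 0) \<and> (\<forall>i. pre i q \<theta> \<noteq> 0) \<and>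
      act j p \<theta> = 1 \<and> act j q \<theta> = 0 \<and> (\<forall>i. i \<noteq> j \<longrightarrow> act i p \<theta> = act i q \<theta>)" for j
    by (rule hyperplane_crossing[OF \<theta>, of j]) blast
  then obtain p q where pq: "\<And>i j. pre i (p j) \<theta> \<noteq> 0" "\<And>i j. pre i (q j) \<theta> \<noteq> 0"
    "\<And>j. act j (p j) \<theta> = 1" "\<And>j. act j (q j) \<theta> = 0"
    "\<And>i j. i \<noteq> j \<Longrightarrow> act i (p j) \<theta> = act i (q j) \<theta>"
    by metis
  \<comment> \<open>Two points per neuron, one on either side of its hyperplane. As \<open>Q\<close>
    is finite, the neighbourhoods of \<open>\<theta>\<close> belonging to its points have an open
    intersection.\<close>
  define Q where "Q = range p \<union> range q"
  have "\<forall>y\<in>Q. \<exists>N. open (fst N) \<and> open (snd N) \<and> \<theta> \<in> fst N \<and> y \<in> snd N \<and>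
      (\<forall>\<theta>'\<in>fst N. \<forall>x\<in>snd N. \<forall>i. pre i x \<theta>' \<noteq> 0 \<and> act i x \<theta>' = act i y \<theta>)"
  proof
    fix y assume "y \<in> Q"
    then have "\<And>i. pre i y \<theta> \<noteq> 0"
      using pq(1,2) by (auto simp: Q_def)
    then obtain A B where "open A" "open B" "\<theta> \<in> A" "y \<in> B"
      "\<And>\<theta>' x i. \<theta>' \<in> A \<Longrightarrow> x \<in> B \<Longrightarrow> pre i x \<theta>' \<noteq> 0 \<and> act i x \<theta>' = act i y \<theta>"
      using activation_locally_constant[of y] by blast
    then show "\<exists>N. open (fst N) \<and> open (snd N) \<and> \<theta> \<in> fst N \<and> y \<in> snd N \<and>
      (\<forall>\<theta>'\<in>fst N. \<forall>x\<in>snd N. \<forall>i. pre i x \<theta>' \<noteq> 0 \<and> act i x \<theta>' = act i y \<theta>)"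
      by (intro exI[of _ "(A, B)"], unfold fst_conv snd_conv) blast
  qed
  from bchoice[OF this] obtain N where N: "\<forall>y\<in>Q. open (fst (N y)) \<and> open (snd (N y)) \<and>
      \<theta> \<in> fst (N y) \<and> y \<in> snd (N y) \<and>
      (\<forall>\<theta>'\<in>fst (N y). \<forall>x\<in>snd (N y). \<forall>i. pre i x \<theta>' \<noteq> 0 \<and> act i x \<theta>' = act i y \<theta>)" ..
  define A B where "A y = fst (N y)" and "B y = snd (N y)" for y
  have AB: "open (A y)" "open (B y)" "\<theta> \<in> A y" "y \<in> B y"
    "\<And>\<theta>' x i. \<theta>' \<in> A y \<Longrightarrow> x \<in> B y \<Longrightarrow> pre i x \<theta>' \<noteq> 0 \<and> act i x \<theta>' = act i y \<theta>" if "y \<in> Q" for y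
    using bspec[OF N that] unfolding A_def B_def by blast+
  show ?thesis
  proof (rule W_at_eq_traceI[OF l \<phi>, where \<Omega> = "admissible \<inter> (\<Inter>y\<in>Q. A y)" and X = "\<Union>y\<in>Q. B y"])
    fix x D h
    assume D: "((\<lambda>\<theta>. net \<theta> x) has_derivative D) (at \<theta>)" and "D\<phi> h = 0"
    \<comment> \<open>Differentiability at \<open>\<theta>\<close> already excludes the bad kinks,
      so \<open>D h\<close> is a combination of values of \<open>dterm\<close> and
      \<open>c h\<close>, all of them zero.\<close>
    have "D = (\<lambda>h. (\<Sum>j\<in>UNIV. act j x \<theta> *\<^sub>R dterm \<theta> h j x) + c h)"
      by (rule has_derivative_unique[OF D has_derivative_net[OF net_differentiable_imp[OF D]]])
    with ker \<open>D\<phi> h = 0\<close> show "D h = 0"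
      by simp
  next
    show "open (admissible \<inter> (\<Inter>y\<in>Q. A y))"
      using AB(1) by (intro open_Int open_INT open_admissible) (auto simp: Q_def)
    show "\<theta> \<in> admissible \<inter> (\<Inter>y\<in>Q. A y)"
      using AB(3) \<theta> by auto
    fix x assume "x \<in> (\<Union>y\<in>Q. B y)"
    then obtain y where y: "y \<in> Q" "x \<in> B y"
      by auto
    show "C2_on (admissible \<inter> (\<Inter>y\<in>Q. A y)) (\<lambda>\<theta>. net \<theta> x)"
    proof (rule C2_on_cong)
      \<comment> \<open>The pattern at \<open>x\<close> for \<open>\<theta>'\<close> is the one at
        \<open>y\<close> for \<open>\<theta>\<close>, so the ReLUs turn into constant
        coefficients.\<close>
      show "net \<theta>' x = (\<Sum>i\<in>UNIV. act i y \<theta> *\<^sub>R pre i x \<theta>' *\<^sub>R u i \<theta>') + c \<theta>'"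
        if "\<theta>' \<in> admissible \<inter> (\<Inter>y\<in>Q. A y)" for \<theta>'
      proof -
        have "act i y \<theta> = act i x \<theta>'" for i
          using AB(5)[OF y(1) _ y(2), of \<theta>' i] that y(1) by auto
        then show ?thesis
          by (auto simp: net_def act_def relu_def intro!: sum.cong)
      qed
      show "C2_on (admissible \<inter> (\<Inter>y\<in>Q. A y)) (\<lambda>\<theta>'. (\<Sum>i\<in>UNIV. act i y \<theta> *\<^sub>R pre i x \<theta>' *\<^sub>R u i \<theta>') + c \<theta>')"
        by (intro C2_on_add C2_on_sum C2_on_const bounded_bilinear.C2_on_prod[OF bounded_bilinear_scaleR]
            C2_on_bounded_linear bounded_linear_pre bounded_linear_u bounded_linear_c)
    qed fact
  next
    fix h
    assume *: "\<And>x D. x \<in> (\<Union>y\<in>Q. B y) \<Longrightarrow> ((\<lambda>\<theta>. net \<theta> x) has_derivative D) (at \<theta>) \<Longrightarrow> D h = 0"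
    \<comment> \<open>With the pattern frozen at that of \<open>y\<close> the sum is affine in the
      input, so its vanishing near \<open>y\<close> extends to all \<open>x\<close>.\<close>
    have G: "(\<Sum>i\<in>UNIV. act i y \<theta> *\<^sub>R dterm \<theta> h i x) + c h = 0" if "y \<in> Q" for x y
    proof (rule affine_eq_0[where B = "B y" and p = y])
      fix x assume x: "x \<in> B y"
      have "(\<Sum>i\<in>UNIV. act i x \<theta> *\<^sub>R dterm \<theta> h i x) + c h = 0"
      proof (rule *[OF _ has_derivative_net])
        show "x \<in> (\<Union>y\<in>Q. B y)"
          using that x by blast
        show "pre j x \<theta> \<noteq> 0 \<or> u j \<theta> = 0 \<or> (\<forall>\<theta>. pre j x \<theta> = 0)" for j
          using AB(5)[OF that AB(3)[OF that] x] by blast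
      qed
      moreover have "act i x \<theta> = act i y \<theta>" for i
        using AB(5)[OF that AB(3)[OF that] x] by simp
      ultimately show "(\<Sum>i\<in>UNIV. act i y \<theta> *\<^sub>R dterm \<theta> h i x) + c h = 0"
        by simp
    next
      show "(\<Sum>i\<in>UNIV. act i y \<theta> *\<^sub>R dterm \<theta> h i (y + t *\<^sub>R (x - y))) + c h =
          (1 - t) *\<^sub>R ((\<Sum>i\<in>UNIV. act i y \<theta> *\<^sub>R dterm \<theta> h i y) + c h) +
          t *\<^sub>R ((\<Sum>i\<in>UNIV. act i y \<theta> *\<^sub>R dterm \<theta> h i x) + c h)" for t x
        unfolding dterm_line
        by (simp add: scaleR_sum_right sum.distrib sum_subtractf algebra_simps)
    qed (use AB(2,4) that in auto)
    have "dterm \<theta> h j x = 0" for j x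
    proof -
      \<comment> \<open>The patterns on the two sides of the hyperplane of \<open>j\<close> differ
        only at \<open>j\<close>, so subtraction leaves one term.\<close>
      have "0 = (\<Sum>i\<in>UNIV. act i (p j) \<theta> *\<^sub>R dterm \<theta> h i x) - (\<Sum>i\<in>UNIV. act i (q j) \<theta> *\<^sub>R dterm \<theta> h i x)"
        using G[of "p j" x] G[of "q j" x] by (simp add: Q_def) (metis add_right_cancel)
      also have "\<dots> = (\<Sum>i\<in>UNIV. if i = j then dterm \<theta> h j x else 0)"
        unfolding sum_subtractf[symmetric] using pq(3-5) by (intro sum.cong) auto
      finally show ?thesis by simp
    qed
    \<comment> \<open>Any neuron supplies a point of \<open>Q\<close>, where now only
      \<open>c h\<close> is left.\<close>
    moreover from this have "c h = 0"
      using G[of "p undefined"] by (simp add: Q_def)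
    ultimately show "D\<phi> h = 0"
      using ker by simp
  qed auto
qed

end

section \<open>The networks with and without biases as instances\<close>

lemma bounded_linear_column: "bounded_linear (column j :: real^'r^'n \<Rightarrow> real^'n)"
  unfolding linear_conv_bounded_linear[symmetric]
  by (rule linearI) (auto simp: vec_eq_iff column_def)

lemma column_0 [simp]: "column j (0 :: real^'r^'n) = 0"
  by (simp add: vec_eq_iff column_def)

lemma bounded_bilinear_outer: "bounded_bilinear (outer :: real^'n \<Rightarrow> real^'m \<Rightarrow> real^'m^'n)"
  unfolding bilinear_conv_bounded_bilinear[symmetric] bilinear_def
  by (auto intro!: linearI simp: vec_eq_iff outer_def algebra_simps)

lemma outer_mult_vector: "outer u v *v x = (v \<bullet> x) *\<^sub>R u"
  by (simp add: vec_eq_iff matrix_vector_mult_def outer_def inner_vec_def sum_distrib_left ac_simps)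

lemma has_derivative_vec:
  assumes "\<And>i. (f i has_derivative f' i) F"
  shows "((\<lambda>x. (\<chi> i. f i x) :: 'a::euclidean_space ^ 'n::finite) has_derivative (\<lambda>h. \<chi> i. f' i h)) F"
  unfolding vec_lambda_eq_sum_axis
  by (intro has_derivative_sum bounded_linear.has_derivative[OF bounded_linear_axis] assms)

text \<open>As a function of \<open>x\<close> the expression is a matrix applied to \<open>x\<close>
  plus a constant vector; \<open>x = 0\<close> isolates the constant. This turns the vanishing of
  \<open>dterm\<close> for one neuron into the vanishing of the matching components of the
  derivative of \<open>\<phi>\<close>.\<close>

lemma affine_rank_one_eq_0_iff:
  fixes u u' :: "real^'n" and v v' :: "real^'m"
  shows "(\<forall>x. (v \<bullet> x + b) *\<^sub>R u' + (v' \<bullet> x + b') *\<^sub>R u = 0) \<longleftrightarrow>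
    outer u v' + outer u' v = 0 \<and> b *\<^sub>R u' + b' *\<^sub>R u = 0" (is "?L \<longleftrightarrow> ?M = 0 \<and> ?B = 0")
proof -
  have eq: "(v \<bullet> x + b) *\<^sub>R u' + (v' \<bullet> x + b') *\<^sub>R u = ?M *v x + ?B" for x
    by (simp add: matrix_vector_mult_add_rdistrib outer_mult_vector algebra_simps)
  show ?thesis
  proof
    assume ?L
    then have L: "?M *v x + ?B = 0" for x
      unfolding eq by blast
    from L[of 0] have B: "?B = 0"
      by simp
    with L have "?M *v x = 0 *v x" for x
      by simp
    then have "?M = 0"
      by (intro matrix_eq[THEN iffD2] allI)
    with B show "?M = 0 \<and> ?B = 0" by simp
  next
    assume "?M = 0 \<and> ?B = 0"
    then show ?L
      unfolding eq by simp
  qed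
qed

interpretation biased: relu_model
  "\<lambda>j \<theta>. column j (fst \<theta>)" "\<lambda>j \<theta>. column j (fst (snd \<theta>))"
  "\<lambda>j \<theta>. fst (snd (snd \<theta>)) $ j" "\<lambda>\<theta> :: ('n::finite, 'm::finite, 'r::finite) bias_params. snd (snd (snd \<theta>))"
proof (rule relu_model.intro)
  fix j and x :: "real^'m"
  show "(\<forall>\<theta> :: ('n, 'm, 'r) bias_params. column j (fst (snd \<theta>)) \<bullet> x + fst (snd (snd \<theta>)) $ j = 0) \<or>
    (\<exists>d :: ('n, 'm, 'r) bias_params. column j (fst (snd d)) \<bullet> x + fst (snd (snd d)) $ j \<noteq> 0 \<and>
      (\<forall>i. i \<noteq> j \<longrightarrow> column i (fst (snd d)) \<bullet> x + fst (snd (snd d)) $ i = 0) \<and>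
      (\<forall>i. column i (fst d) = 0) \<and> snd (snd (snd d)) = 0)"
    \<comment> \<open>Moving the bias of neuron \<open>j\<close> alone changes no other
      preactivation.\<close>
    by (intro disjI2 exI[of _ "(0, 0, axis j 1, 0)"]) (simp add: axis_def)
qed (intro bounded_linear_compose[OF bounded_linear_column] bounded_linear_compose[OF bounded_linear_vec_nth]
    bounded_linear_fst bounded_linear_snd bounded_linear_fst_comp bounded_linear_snd_comp)+

interpretation unbiased: relu_model
  "\<lambda>j \<theta>. column j (fst \<theta>)" "\<lambda>j \<theta>. column j (snd \<theta>)" "\<lambda>j \<theta>. 0"
  "\<lambda>\<theta> :: (real^'r::finite^'n::finite) \<times> (real^'r^'m::finite). 0"
proof (rule relu_model.intro)
  fix j and x :: "real^'m"
  show "(\<forall>\<theta> :: (real^'r^'n) \<times> (real^'r^'m). column j (snd \<theta>) \<bullet> x + 0 = 0) \<or>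
    (\<exists>d :: (real^'r^'n) \<times> (real^'r^'m). column j (snd d) \<bullet> x + 0 \<noteq> 0 \<and>
      (\<forall>i. i \<noteq> j \<longrightarrow> column i (snd d) \<bullet> x + 0 = 0) \<and> (\<forall>i. column i (fst d) = 0) \<and> (0::real^'n) = 0)"
  proof (cases "x = 0")
    case False
    \<comment> \<open>Moving the weight vector of neuron \<open>j\<close> in the direction
      \<open>x\<close> gives the preactivation \<open>x \<bullet> x\<close>, nonzero here; for
      \<open>x = 0\<close> all preactivations vanish identically.\<close>
    define V :: "real^'r^'m" where "V = (\<chi> a k. if k = j then x $ a else 0)"
    have "column j V = x" "\<And>i. i \<noteq> j \<Longrightarrow> column i V = 0"
      by (simp_all add: V_def column_def vec_eq_iff)
    with False show ?thesis
      by (intro disjI2 exI[of _ "(0, V)"]) simp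
  qed simp
qed (intro bounded_linear_compose[OF bounded_linear_column] bounded_linear_zero
    bounded_linear_fst bounded_linear_snd)+

lemma relu_net_eq: "relu_net = biased.net"
  by (auto simp: fun_eq_iff relu_net_def biased.net_def biased.pre_def)

lemma relu_dom_eq: "relu_dom = biased.admissible"
  by (auto simp: relu_dom_def biased.admissible_def biased.pre_def)

lemma relu_net0_eq: "relu_net0 = unbiased.net"
  by (auto simp: fun_eq_iff relu_net0_def unbiased.net_def unbiased.pre_def)

lemma relu_dom0_eq: "relu_dom0 = unbiased.admissible"
  by (auto simp: relu_dom0_def unbiased.admissible_def unbiased.pre_def)

lemma relu_phi_has_derivative:
  fixes \<theta> :: "('n::finite, 'm::finite, 'r::finite) bias_params"
  shows "(relu_phi has_derivative (\<lambda>h.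
    (\<chi> j. (outer (column j (fst \<theta>)) (column j (fst (snd h))) + outer (column j (fst h)) (column j (fst (snd \<theta>))),
       fst (snd (snd \<theta>)) $ j *\<^sub>R column j (fst h) + fst (snd (snd h)) $ j *\<^sub>R column j (fst \<theta>)),
     snd (snd (snd h))))) (at \<theta>)"
proof -
  have eq: "relu_phi = (\<lambda>\<theta> :: ('n, 'm, 'r) bias_params.
      (\<chi> j. (outer (column j (fst \<theta>)) (column j (fst (snd \<theta>))), fst (snd (snd \<theta>)) $ j *\<^sub>R column j (fst \<theta>)),
       snd (snd (snd \<theta>))))"
    by (auto simp: relu_phi_def)
  show ?thesis
    unfolding eq
    by (intro has_derivative_Pair has_derivative_vec has_derivative_scaleR
        bounded_bilinear.FDERIV[OF bounded_bilinear_outer] bounded_linear_imp_has_derivative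
        biased.bounded_linear_u biased.bounded_linear_v biased.bounded_linear_b biased.bounded_linear_c)
qed

lemma relu_phi0_has_derivative:
  fixes \<theta> :: "(real^'r::finite^'n::finite) \<times> (real^'r^'m::finite)"
  shows "(relu_phi0 has_derivative (\<lambda>h.
    \<chi> j. outer (column j (fst \<theta>)) (column j (snd h)) + outer (column j (fst h)) (column j (snd \<theta>)))) (at \<theta>)"
proof -
  have eq: "relu_phi0 = (\<lambda>\<theta> :: (real^'r^'n) \<times> (real^'r^'m). \<chi> j. outer (column j (fst \<theta>)) (column j (snd \<theta>)))"
    by (auto simp: relu_phi0_def)
  show ?thesis
    unfolding eq
    by (intro has_derivative_vec bounded_bilinear.FDERIV[OF bounded_bilinear_outer]
        bounded_linear_imp_has_derivative unbiased.bounded_linear_u unbiased.bounded_linear_v)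
qed

theorem theorem2p14:
  fixes l :: "real^'n::finite \<Rightarrow> 'y \<Rightarrow> real"
  assumes "\<And>y. C2_on UNIV (\<lambda>z. l z y)"
    and "\<And>z. span {grad (\<lambda>z. l z y) z | y. True} = UNIV"
  shows
    "(\<forall>(q::nat) (dims :: nat \<Rightarrow> nat) (out_ix :: 'n \<Rightarrow> nat) (in_ix :: 'm::finite \<Rightarrow> nat)
        (pos :: nat \<times> nat \<times> nat \<Rightarrow> 'p::finite).
        1 \<le> q \<and> lin_layout q dims out_ix in_ix pos \<longrightarrow>
        (\<forall>\<theta>. W_at UNIV l (lin_net q dims out_ix in_ix pos) \<theta>
              = trace_at (W_of (lin_phi q dims out_ix in_ix pos)) \<theta>))
     \<and> (\<forall>\<theta> \<in> (relu_dom :: ('n, 'm, 'r::finite) bias_params set).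
          W_at relu_dom l relu_net \<theta> = trace_at (W_of relu_phi) \<theta>)
     \<and> (\<forall>\<theta> \<in> (relu_dom0 :: ((real^'r^'n) \<times> (real^'r^'m)) set).
          W_at relu_dom0 l relu_net0 \<theta> = trace_at (W_of relu_phi0) \<theta>)"
proof (intro conjI allI impI ballI)
  show "W_at UNIV l (lin_net q dims out_ix in_ix pos) \<theta> = trace_at (W_of (lin_phi q dims out_ix in_ix pos)) \<theta>"
    for q dims out_ix and in_ix :: "'m \<Rightarrow> nat" and pos :: "nat \<times> nat \<times> nat \<Rightarrow> 'p" and \<theta>
    by (rule W_at_lin_net[OF assms])
next
  fix \<theta> :: "('n, 'm, 'r) bias_params"
  assume "\<theta> \<in> relu_dom"
  then show "W_at relu_dom l relu_net \<theta> = trace_at (W_of relu_phi) \<theta>"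
    unfolding relu_dom_eq relu_net_eq
  proof (rule biased.W_at_net[OF assms _ relu_phi_has_derivative])
    show "((\<chi> j. (outer (column j (fst \<theta>)) (column j (fst (snd h))) + outer (column j (fst h)) (column j (fst (snd \<theta>))),
       fst (snd (snd \<theta>)) $ j *\<^sub>R column j (fst h) + fst (snd (snd h)) $ j *\<^sub>R column j (fst \<theta>)),
     snd (snd (snd h))) = 0) \<longleftrightarrow> (\<forall>j x. biased.dterm \<theta> h j x = 0) \<and> snd (snd (snd h)) = 0" for h
      unfolding biased.dterm_def biased.pre_def affine_rank_one_eq_0_iff
      by (simp add: vec_eq_iff zero_prod_def)
  qed
next
  fix \<theta> :: "(real^'r^'n) \<times> (real^'r^'m)"
  assume "\<theta> \<in> relu_dom0"
  then show "W_at relu_dom0 l relu_net0 \<theta> = trace_at (W_of relu_phi0) \<theta>"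
    unfolding relu_dom0_eq relu_net0_eq
  proof (rule unbiased.W_at_net[OF assms _ relu_phi0_has_derivative])
    show "((\<chi> j. outer (column j (fst \<theta>)) (column j (snd h)) + outer (column j (fst h)) (column j (snd \<theta>))) = 0)
      \<longleftrightarrow> (\<forall>j x. unbiased.dterm \<theta> h j x = 0) \<and> (0::real^'n) = 0" for h
      \<comment> \<open>Both constants in the affine map are 0, so only the matrix equation
        remains.\<close>
      unfolding unbiased.dterm_def unbiased.pre_def affine_rank_one_eq_0_iff
      by (simp add: vec_eq_iff)
  qed
qed

end
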